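(* There exist a discrete probability measure $\mu$ on the unit circle $\mathbb{T}$ and a countable closed set $E\subset\mathbb{T}$ such that $\mu(E)=0$ and $E$ is a uniqueness set for $\mathcal{D}(\mu)$.
   Context: For a positive finite Borel measure $\mu$ on $\mathbb{T}$, $f\in L^2(\mathbb{T})$ and $\xi\in\mathbb{T}$, the local Dirichlet integral is $$\mathcal{D}_\xi(f)=\int_{\mathbb{T}}\Big|\frac{f(\zeta)-f(\xi)}{\zeta-\xi}\Big|^2\frac{|d\zeta|}{2\pi},$$ where $|d\zeta|$ is arc length and $f(\xi)$ is the non-tangential limit at $\xi$ of the Poisson extension of $f$ (with the standard convention $\mathcal{D}_\xi(f)=\infty$ if this limit does not exist). Put $\mathcal{D}_\mu(f)=\int_{\mathbb{T}}\mathcal{D}_\xi(f)\,d\mu(\xi)$. The harmonically weighted Dirichlet space $\mathcal{D}^h(\mu)$ is the set of $f\in L^2(\mathbb{T})$ with $\mathcal{D}_\mu(f)<\infty$, with norm $\|f\|_\mu^2=\|f\|_{L^2(\mathbb{T})}^2+\mathcal{D}_\mu(f)$, where the $L^2$ norm is taken with respect to $|d\zeta|/2\pi$. The analytic space is $\mathcal{D}(\mu)=\{f\in\mathcal{D}^h(\mu):\widehat f(n)=0 \text{ for } n<0\}$. The capacity associated with $\mathcal{D}(\mu)$ is $$c_\mu(E)=\inf\{\|f\|_\mu^2: f\in\mathcal{D}^h(\mu),\ |f|\ge 1 \text{ a.e. on a neighborhood of } E\}.$$ A property holds $c_\mu$-quasi-everywhere ($c_\mu$-q.e.) if it holds outside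 a set of $c_\mu$-capacity zero. Every $f\in\mathcal{D}(\mu)$ has non-tangential limits $f(\zeta)$ for $c_\mu$-q.e. $\zeta\in\mathbb{T}$. A set $E\subset\mathbb{T}$ is a uniqueness set for $\mathcal{D}(\mu)$ if every $f\in\mathcal{D}(\mu)$ whose non-tangential limit is $0$ $c_\mu$-q.e. on $E$ is identically $0$. A discrete measure is a countable sum of point masses. *)

theory Defs
  imports "HOL-Probability.Probability"
begin

abbreviation circle :: "complex set" (\<open>\<T>\<close>)
  where "\<T> \<equiv> sphere 0 1"

definition circle_borel :: "complex measure"
  where "circle_borel = restrict_space borel \<T>"

text \<open>Normalised arc length, \<open>|d\<zeta>| / 2\<pi>\<close>.\<close>

definition arc_length :: "complex measure"
  where "arc_length = distr (uniform_measure lborel {0..<2*pi}) circle_borel cis"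

text \<open>An element of \<open>L\<^sup>2(\<T>)\<close> is represented by any of its Borel representatives. All notions
  below depend only on the almost-everywhere class of the representative; in particular the
  boundary value of \<open>f\<close> at \<open>\<xi>\<close> is never the pointwise value \<open>f \<xi>\<close>, but always the
  non-tangential limit of the Poisson extension.\<close>

definition L2_norm_sq :: "(complex \<Rightarrow> complex) \<Rightarrow> ennreal"
  where "L2_norm_sq f = (\<integral>\<^sup>+\<zeta>. ennreal ((cmod (f \<zeta>))\<^sup>2) \<partial>arc_length)"

definition L2_circle :: "(complex \<Rightarrow> complex) set"
  where "L2_circle = {f \<in> borel_measurable arc_length. L2_norm_sq f < \<infinity>}"

definition fourier_coeff :: "(complex \<Rightarrow> complex) \<Rightarrow> int \<Rightarrow> complex"
  where "fourier_coeff f n = (LINT \<zeta>|arc_length. f \<zeta> * \<zeta> powi (- n))"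

definition poisson_ext :: "(complex \<Rightarrow> complex) \<Rightarrow> complex \<Rightarrow> complex"
  where "poisson_ext f z =
    (LINT \<zeta>|arc_length. ((1 - (cmod z)\<^sup>2) / (cmod (\<zeta> - z))\<^sup>2) *\<^sub>R f \<zeta>)"

definition stolz_region :: "real \<Rightarrow> complex \<Rightarrow> complex set"
  where "stolz_region \<alpha> \<xi> = {z. cmod z < 1 \<and> cmod (z - \<xi>) < \<alpha> * (1 - cmod z)}"

definition has_nt_limit :: "(complex \<Rightarrow> complex) \<Rightarrow> complex \<Rightarrow> complex \<Rightarrow> bool"
  where "has_nt_limit f \<xi> l \<longleftrightarrow>
    (\<forall>\<alpha>>1. (poisson_ext f \<longlongrightarrow> l) (at \<xi> within stolz_region \<alpha> \<xi>))"

definition nt_limit :: "(complex \<Rightarrow> complex) \<Rightarrow> complex \<Rightarrow> complex"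
  where "nt_limit f \<xi> = (THE l. has_nt_limit f \<xi> l)"

definition local_dirichlet :: "complex \<Rightarrow> (complex \<Rightarrow> complex) \<Rightarrow> ennreal"
  where "local_dirichlet \<xi> f =
    (if \<exists>l. has_nt_limit f \<xi> l
     then \<integral>\<^sup>+\<zeta>. ennreal ((cmod ((f \<zeta> - nt_limit f \<xi>) / (\<zeta> - \<xi>)))\<^sup>2) \<partial>arc_length
     else \<infinity>)"

definition dirichlet_integral :: "complex measure \<Rightarrow> (complex \<Rightarrow> complex) \<Rightarrow> ennreal"
  where "dirichlet_integral \<mu> f = (\<integral>\<^sup>+\<xi>. local_dirichlet \<xi> f \<partial>\<mu>)"

definition harmonic_dirichlet_space :: "complex measure \<Rightarrow> (complex \<Rightarrow> complex) set"
  where "harmonic_dirichlet_space \<mu> = {f \<in> L2_circle. dirichlet_integral \<mu> f < \<infinity>}"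

definition dirichlet_norm_sq :: "complex measure \<Rightarrow> (complex \<Rightarrow> complex) \<Rightarrow> ennreal"
  where "dirichlet_norm_sq \<mu> f = L2_norm_sq f + dirichlet_integral \<mu> f"

definition dirichlet_space :: "complex measure \<Rightarrow> (complex \<Rightarrow> complex) set"
  where "dirichlet_space \<mu> = {f \<in> harmonic_dirichlet_space \<mu>. \<forall>n<0. fourier_coeff f n = 0}"

definition capacity :: "complex measure \<Rightarrow> complex set \<Rightarrow> ennreal"
  where "capacity \<mu> E =
    (INF f \<in> {f \<in> harmonic_dirichlet_space \<mu>.
        \<exists>U. open U \<and> E \<subseteq> U \<and> (AE \<zeta> in arc_length. \<zeta> \<in> U \<longrightarrow> 1 \<le> cmod (f \<zeta>))}.
      dirichlet_norm_sq \<mu> f)"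

definition quasi_everywhere_on :: "complex measure \<Rightarrow> complex set \<Rightarrow> (complex \<Rightarrow> bool) \<Rightarrow> bool"
  where "quasi_everywhere_on \<mu> E P \<longleftrightarrow>
    (\<exists>N \<subseteq> \<T>. capacity \<mu> N = 0 \<and> (\<forall>\<zeta> \<in> E - N. P \<zeta>))"

definition uniqueness_set :: "complex measure \<Rightarrow> complex set \<Rightarrow> bool"
  where "uniqueness_set \<mu> E \<longleftrightarrow>
    (\<forall>f \<in> dirichlet_space \<mu>.
      quasi_everywhere_on \<mu> E (\<lambda>\<zeta>. has_nt_limit f \<zeta> 0) \<longrightarrow> (AE \<zeta> in arc_length. f \<zeta> = 0))"

text \<open>Weights may vanish, so finite sums of point masses are included.\<close>

definition discrete_measure :: "'a measure \<Rightarrow> bool"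
  where "discrete_measure \<mu> \<longleftrightarrow>
    (\<exists>(x :: nat \<Rightarrow> 'a) (c :: nat \<Rightarrow> ennreal). range x \<subseteq> space \<mu> \<and>
      (\<forall>A \<in> sets \<mu>. emeasure \<mu> A = (\<Sum>n. c n * indicator A (x n))))"

end

theory Submission
  imports Defs "HOL-Complex_Analysis.Complex_Analysis" "HOL-Real_Asymp.Real_Asymp"
begin

text \<open>
  \<open>E\<close> consists of the point \<open>1\<close> and nodes \<open>\<xi>\<^sub>i \<rightarrow> 1\<close> whose discs of radius \<open>\<rho>\<^sub>i\<close> cover
  \<open>\<T> - {1}\<close>, where \<open>\<Sum>\<rho>\<^sub>i < \<infinity>\<close> but \<open>\<rho>\<^sub>i\<close> decays like \<open>exp (- c / |\<xi>\<^sub>i - 1|\<^sup>2)\<close>. Near each node sits a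
  sequence of atoms converging to it geometrically, of total mass comparable to \<open>\<rho>\<^sub>i\<close>. If \<open>f\<close>
  has finite local Dirichlet integral at an atom \<open>a\<close>, its Poisson extension is close to \<open>f(a)\<close> at
  points of the disc near \<open>a\<close>; telescoping along the atoms ties \<open>f(a)\<close> to the non-tangential
  limit at the node. On the one hand this gives every node positive capacity. On the other hand,
  if \<open>f\<close> vanishes at the node, then \<open>\<integral>|f|\<^sup>2\<close> over its disc is at most a constant times \<open>\<rho>\<^sub>i\<close>
  times the energy of \<open>f\<close> at its atoms, so that \<open>\<integral>|f|\<^sup>2 exp (16 / |1 - \<zeta>|\<^sup>2) < \<infinity>\<close>. Testing an
  analytic \<open>f\<close> against holomorphic functions bounded by the square root of this weight, but
  arbitrarily large at \<open>0\<close>, kills all its Fourier coefficients.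
\<close>

subsection \<open>Normalised arc length\<close>

lemma sets_arc_length [measurable_cong]: "sets arc_length = sets circle_borel"
  by (simp add: arc_length_def)

lemma space_circle_borel: "space circle_borel = \<T>"
  by (simp add: circle_borel_def space_restrict_space)

lemma space_arc_length: "space arc_length = \<T>"
  by (simp add: arc_length_def space_circle_borel)

lemma measurable_cis: "cis \<in> borel \<rightarrow>\<^sub>M circle_borel"
  unfolding circle_borel_def
  by (intro measurable_restrict_space2) (auto intro!: borel_measurable_continuous_onI continuous_intros)

lemma measurable_cis_uniform: "cis \<in> uniform_measure lborel A \<rightarrow>\<^sub>M circle_borel"
  using measurable_cis by (simp cong: measurable_cong_sets)

lemma prob_space_arc_length: "prob_space arc_length"
proof -
  have "prob_space (uniform_measure lborel {0..<2*pi})"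
    by (rule prob_space_uniform_measure) auto
  then show ?thesis
    unfolding arc_length_def
    by (rule prob_space.prob_space_distr) (rule measurable_cis_uniform)
qed

interpretation arc: prob_space arc_length
  by (rule prob_space_arc_length)

lemma borel_imp_circle_borel: "f \<in> borel_measurable borel \<Longrightarrow> f \<in> borel_measurable circle_borel"
  unfolding circle_borel_def by (rule measurable_restrict_space1)

lemma measurable_ident_circle [measurable]: "(\<lambda>\<zeta>. \<zeta>) \<in> borel_measurable circle_borel"
  by (rule borel_imp_circle_borel) simp

lemma Int_circle_in_sets: "A \<in> sets borel \<Longrightarrow> A \<inter> \<T> \<in> sets circle_borel"
  by (auto simp: circle_borel_def sets_restrict_space)

lemma emeasure_arc_length:
  assumes "A \<in> sets circle_borel"
  shows "emeasure arc_length A = emeasure lborel ({0..<2*pi} \<inter> cis -` A) / ennreal (2*pi)"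
proof -
  have "cis -` A \<in> sets borel"
    using measurable_sets[OF measurable_cis assms] by simp
  then show ?thesis
    unfolding arc_length_def using assms
    by (subst emeasure_distr) (auto simp: measurable_cis_uniform)
qed

lemma circle_cis:
  assumes "a \<in> \<T>" obtains t where "a = cis t" "0 \<le> t" "t < 2*pi"
  using assms by (metis Arg2pi atLeastLessThan_iff cis_conv_exp is_Arg_def mem_sphere_0 mult_1 of_real_1)

lemma arc_length_singleton: "emeasure arc_length {a} = 0"
proof (cases "a \<in> \<T>")
  case True
  then have *: "{a} \<in> sets circle_borel"
    using Int_circle_in_sets[of "{a}"] by simp
  have "\<exists>b. {0..<2*pi} \<inter> cis -` {a} \<subseteq> {b}"
  proof -
    obtain t where t: "a = cis t" "0 \<le> t" "t < 2*pi" using True by (rule circle_cis)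
    have "u = t" if "0 \<le> u" "u < 2*pi" "cis u = a" for u
    proof -
      have "Arg2pi (cis x) = x" if "0 \<le> x" "x < 2*pi" for x
        by (rule Arg2pi_unique[of 1]) (use that in \<open>auto simp: cis_conv_exp\<close>)
      with that t show ?thesis by metis
    qed
    then have "{0..<2*pi} \<inter> cis -` {a} \<subseteq> {t}" by auto
    then show ?thesis ..
  qed
  then obtain b where b: "{0..<2*pi} \<inter> cis -` {a} \<subseteq> {b}" by blast
  then have "emeasure lborel ({0..<2*pi} \<inter> cis -` {a}) \<le> emeasure lborel {b}"
    by (intro emeasure_mono) auto
  then show ?thesis by (simp add: emeasure_arc_length[OF *])
next
  case False
  then show ?thesis by (intro emeasure_notin_sets) (auto simp: sets_arc_length circle_borel_def sets_restrict_space)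
qed

text \<open>Serves to cancel \<open>\<zeta> - a\<close> in difference quotients: at the centre the
  quotient is 0 because \<open>x / 0 = 0\<close>, so such identities hold only almost
  everywhere.\<close>

lemma AE_arc_length_neq: "AE \<zeta> in arc_length. \<zeta> \<noteq> a"
proof (cases "a \<in> \<T>")
  case True
  then have "{a} \<in> sets arc_length"
    using Int_circle_in_sets[of "{a}"] by (simp add: sets_arc_length)
  then have "{a} \<in> null_sets arc_length"
    by (simp add: null_sets_def arc_length_singleton)
  from AE_not_in[OF this] show ?thesis by simp
qed (auto intro!: AE_I2 simp: space_arc_length)

lemma cmod_cis_diff: "cmod (cis a - cis b) = 2 * \<bar>sin ((a - b) / 2)\<bar>"
proof -
  have "cis a - cis b = cis b * (cis (a - b) - 1)"
    by (simp add: cis_mult algebra_simps)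
  then show ?thesis
    using dist_exp_i_1[of "a - b"] by (simp add: norm_mult cis_conv_exp)
qed

lemma dist_cis_le: "cmod (cis a - cis b) \<le> \<bar>a - b\<bar>"
  using abs_sin_x_le_abs_x[of "(a - b) / 2"] by (simp add: cmod_cis_diff)

lemma emeasure_cball_arc_length:
  assumes "a \<in> \<T>" "0 < s" "s \<le> pi"
  shows "ennreal (s / (2*pi)) \<le> emeasure arc_length (cball a s \<inter> \<T>)"
proof -
  obtain t where t: "a = cis t" "0 \<le> t" "t < 2*pi" using assms(1) by (rule circle_cis)
  \<comment> \<open>A one-sided interval, placed on the side where it stays inside
    \<open>{0..<2*pi}\<close>, avoids any wrap-around of the angle; this costs only a factor 2 in
    the bound.\<close>
  define J where "J = (if t < pi then {t..<t+s} else {t-s..<t})"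
  have J: "J \<subseteq> {0..<2*pi} \<inter> cis -` (cball a s \<inter> \<T>)"
  proof
    fix u assume u: "u \<in> J"
    then have "\<bar>t - u\<bar> \<le> s" "0 \<le> u" "u < 2*pi"
      using assms t by (auto simp: J_def split: if_splits)
    moreover have "dist a (cis u) \<le> \<bar>t - u\<bar>"
      unfolding t dist_norm by (rule dist_cis_le)
    ultimately show "u \<in> {0..<2*pi} \<inter> cis -` (cball a s \<inter> \<T>)" by simp
  qed
  have m: "cball a s \<inter> \<T> \<in> sets circle_borel"
    by (rule Int_circle_in_sets) simp
  have "cis -` (cball a s \<inter> \<T>) \<in> sets borel"
    using measurable_sets[OF measurable_cis m] by simp
  then have "emeasure lborel J \<le> emeasure lborel ({0..<2*pi} \<inter> cis -` (cball a s \<inter> \<T>))"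
    by (intro emeasure_mono J) auto
  moreover have "emeasure lborel J = ennreal s"
    using assms by (auto simp: J_def)
  ultimately show ?thesis
    using assms by (simp add: emeasure_arc_length[OF m] divide_ennreal[symmetric] divide_right_mono_ennreal)
qed

section \<open>Orthogonality of the characters\<close>

lemma measurable_powi [measurable]: "(\<lambda>\<zeta>. \<zeta> powi k) \<in> borel_measurable circle_borel"
  unfolding power_int_def by measurable

lemma integral_powi: "(LINT \<zeta>|arc_length. \<zeta> powi k) = (if k = 0 then 1 else 0)"
proof (cases "k = 0")
  case True
  then show ?thesis using arc.prob_space by simp
next
  case False
  have cisk [measurable]: "(\<lambda>t. cis (of_int k * t)) \<in> borel_measurable borel"
    by (intro borel_measurable_continuous_onI continuous_intros)
  \<comment> \<open>The endpoint \<open>2*pi\<close> is added, at the cost of a null set, because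
    the fundamental theorem is applied on a closed interval.\<close>
  have ae: "AE t in lborel. (indicator {0..<2*pi} t / (2*pi)) *\<^sub>R cis (of_int k * t)
      = (1 / (2*pi)) *\<^sub>R (indicator {0..2*pi} t *\<^sub>R cis (of_int k * t))"
    using AE_lborel_singleton[of "2*pi"] by eventually_elim (auto split: split_indicator)
  let ?F = "\<lambda>t. cis (of_int k * t) / (\<i> * of_int k)"
  have F: "(?F has_vector_derivative cis (of_int k * t)) (at t within S)" for t S
    using False unfolding has_vector_derivative_def
    by (auto intro!: derivative_eq_intros simp: scaleR_conv_of_real field_simps)
  have "(LINT \<zeta>|arc_length. \<zeta> powi k) = (LINT t|uniform_measure lborel {0..<2*pi}. cis (of_int k * t))"
    unfolding arc_length_def by (subst integral_distr[OF _ measurable_powi]) (auto simp: measurable_cis_uniform cis_power_int)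
  also have "uniform_measure lborel {0..<2*pi} = density lborel (\<lambda>t. ennreal (indicator {0..<2*pi} t / (2*pi)))"
    unfolding uniform_measure_def
    by (intro density_cong) (auto simp: divide_ennreal[symmetric] ennreal_indicator split: split_indicator)
  also have "(LINT t|\<dots>. cis (of_int k * t)) = (LINT t|lborel. (indicator {0..<2*pi} t / (2*pi)) *\<^sub>R cis (of_int k * t))"
    by (intro integral_density) (auto intro!: borel_measurable_continuous_onI continuous_intros)
  also have "\<dots> = (LINT t|lborel. (1 / (2*pi)) *\<^sub>R (indicator {0..2*pi} t *\<^sub>R cis (of_int k * t)))"
    by (rule integral_cong_AE[OF _ _ ae]) simp_all
  also have "\<dots> = (1 / (2*pi)) *\<^sub>R (LINT t|lborel. indicator {0..2*pi} t *\<^sub>R cis (of_int k * t))"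
    by (rule integral_scaleR_right)
  also have "(LINT t|lborel. indicator {0..2*pi} t *\<^sub>R cis (of_int k * t)) = ?F (2*pi) - ?F 0"
    by (intro integral_FTC_atLeastAtMost F continuous_intros) auto
  also have "?F (2*pi) = ?F 0"
    using cis_multiple_2pi[of "of_int k"] by (simp add: mult.commute mult.left_commute)
  finally show ?thesis using False by simp
qed

subsection \<open>Uniqueness of Fourier coefficients\<close>

lemma integrable_mult_bounded:
  fixes f g :: "complex \<Rightarrow> complex"
  assumes "integrable arc_length f" and [measurable]: "g \<in> borel_measurable circle_borel"
    and "\<And>\<zeta>. \<zeta> \<in> \<T> \<Longrightarrow> cmod (g \<zeta>) \<le> B"
  shows "integrable arc_length (\<lambda>\<zeta>. f \<zeta> * g \<zeta>)"
proof (rule Bochner_Integration.integrable_bound)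
  show "integrable arc_length (\<lambda>\<zeta>. B *\<^sub>R f \<zeta>)"
    using assms(1) by simp
  show "(\<lambda>\<zeta>. f \<zeta> * g \<zeta>) \<in> borel_measurable arc_length"
    using borel_measurable_integrable[OF assms(1)] by measurable
  show "AE \<zeta> in arc_length. cmod (f \<zeta> * g \<zeta>) \<le> cmod (B *\<^sub>R f \<zeta>)"
  proof (rule AE_I2)
    fix \<zeta> assume "\<zeta> \<in> space arc_length"
    then have "cmod (g \<zeta>) \<le> \<bar>B\<bar>" using assms(3)[of \<zeta>] by (simp add: space_arc_length)
    then have "cmod (f \<zeta>) * cmod (g \<zeta>) \<le> cmod (f \<zeta>) * \<bar>B\<bar>" by (intro mult_left_mono) auto
    then show "cmod (f \<zeta> * g \<zeta>) \<le> cmod (B *\<^sub>R f \<zeta>)"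
      by (simp add: norm_mult mult.commute)
  qed
qed

lemma norm_powi_circle [simp]: "\<zeta> \<in> \<T> \<Longrightarrow> cmod (\<zeta> powi k) = 1"
  by (simp add: norm_power_int)

lemma circle_powi_add: "cmod \<zeta> = 1 \<Longrightarrow> \<zeta> powi (j + k) = \<zeta> powi j * \<zeta> powi k"
  by (rule power_int_add) auto

lemma integrable_mult_powi:
  "integrable arc_length f \<Longrightarrow> integrable arc_length (\<lambda>\<zeta>. f \<zeta> * \<zeta> powi k)"
  by (rule integrable_mult_bounded[where B = 1]) auto

text \<open>With \<open>k\<close> ranging over all integers, these integrals are the Fourier
  coefficients in reversed order. Integrability is bundled in so that the closure properties below
  can be iterated.\<close>

definition fourier_null :: "(complex \<Rightarrow> complex) \<Rightarrow> bool" where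
  "fourier_null f \<longleftrightarrow> integrable arc_length f \<and> (\<forall>k. (LINT \<zeta>|arc_length. f \<zeta> * \<zeta> powi k) = 0)"

lemma fourier_null_add:
  "fourier_null f \<Longrightarrow> fourier_null g \<Longrightarrow> fourier_null (\<lambda>\<zeta>. f \<zeta> + g \<zeta>)"
  by (simp add: fourier_null_def distrib_right integrable_mult_powi)

lemma fourier_null_mult_const:
  assumes "fourier_null f" shows "fourier_null (\<lambda>\<zeta>. f \<zeta> * c)"
proof -
  have "(LINT \<zeta>|arc_length. f \<zeta> * c * \<zeta> powi k) = (LINT \<zeta>|arc_length. f \<zeta> * \<zeta> powi k * c)" for k
    by (simp only: mult.assoc mult.commute[of c])
  then show ?thesis using assms by (simp add: fourier_null_def)
qed

lemma fourier_null_cong: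
  assumes "\<And>\<zeta>. \<zeta> \<in> \<T> \<Longrightarrow> f \<zeta> = g \<zeta>" "fourier_null f"
  shows "fourier_null g"
proof -
  have "integrable arc_length f = integrable arc_length g"
    by (rule Bochner_Integration.integrable_cong) (auto simp: space_arc_length assms(1))
  moreover have "(LINT \<zeta>|arc_length. f \<zeta> * \<zeta> powi k) = (LINT \<zeta>|arc_length. g \<zeta> * \<zeta> powi k)" for k
    by (rule Bochner_Integration.integral_cong) (auto simp: space_arc_length assms(1))
  ultimately show ?thesis using assms(2) by (simp add: fourier_null_def)
qed

lemma fourier_null_mult_powi:
  assumes "fourier_null f"
  shows "fourier_null (\<lambda>\<zeta>. f \<zeta> * \<zeta> powi j)"
proof -
  have "(LINT \<zeta>|arc_length. f \<zeta> * \<zeta> powi j * \<zeta> powi k) = (LINT \<zeta>|arc_length. f \<zeta> * \<zeta> powi (j + k))" for k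
    by (rule Bochner_Integration.integral_cong) (simp_all add: space_arc_length circle_powi_add mult.assoc)
  then show ?thesis using assms by (simp add: fourier_null_def integrable_mult_powi)
qed

text \<open>On the circle a real linear form is a combination of \<open>\<zeta>\<close> and its
  inverse, and multiplying by powers of \<open>\<zeta>\<close> only shifts the coefficients.
  Generalising over \<open>f\<close> lets the product case apply one induction hypothesis after the
  other.\<close>

lemma fourier_null_mult_polynomial:
  assumes "real_polynomial_function p" "fourier_null f"
  shows "fourier_null (\<lambda>\<zeta>. f \<zeta> * of_real (p \<zeta>))"
  using assms
proof (induction arbitrary: f rule: real_polynomial_function.induct)
  case (linear p)
  \<comment> \<open>The coefficients come from \<open>Re \<zeta> = (\<zeta> + 1/\<zeta>) / 2\<close>
    and \<open>Im \<zeta> = (\<zeta> - 1/\<zeta>) / (2 * \<i>)\<close>.\<close>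
  define \<alpha> where "\<alpha> = (of_real (p 1) - \<i> * of_real (p \<i>)) / 2"
  define \<beta> where "\<beta> = (of_real (p 1) + \<i> * of_real (p \<i>)) / 2"
  have eq: "f \<zeta> * \<zeta> powi 1 * \<alpha> + f \<zeta> * \<zeta> powi (-1) * \<beta> = f \<zeta> * of_real (p \<zeta>)" if "\<zeta> \<in> \<T>" for \<zeta>
  proof -
    have "p \<zeta> = p (Re \<zeta> *\<^sub>R 1 + Im \<zeta> *\<^sub>R \<i>)"
      by (rule arg_cong[of _ _ p]) (simp add: complex_eq_iff)
    also have "\<dots> = Re \<zeta> * p 1 + Im \<zeta> * p \<i>"
      unfolding linear_simps(1,5)[OF linear(1)] by simp
    finally have p: "p \<zeta> = Re \<zeta> * p 1 + Im \<zeta> * p \<i>" .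
    have inv: "\<zeta> powi (-1) = cnj \<zeta>"
      using that by (simp add: power_int_minus inverse_eq_divide divide_conv_cnj)
    have "\<zeta> powi 1 * \<alpha> + \<zeta> powi (-1) * \<beta> = of_real (p \<zeta>)"
      unfolding inv p \<alpha>_def \<beta>_def by (simp add: complex_eq_iff field_simps)
    then show ?thesis by (metis distrib_left mult.assoc)
  qed
  show ?case
    by (rule fourier_null_cong[OF eq], assumption)
       (rule fourier_null_add fourier_null_mult_const fourier_null_mult_powi linear(2))+
next
  case (const c)
  then show ?case by (rule fourier_null_mult_const)
next
  case (add p q)
  show ?case
    using fourier_null_add[OF add.IH(1)[OF add.prems] add.IH(2)[OF add.prems]]
    by (simp only: of_real_add distrib_left)
next
  case (mult p q)
  show ?case
    using mult.IH(2)[OF mult.IH(1)[OF mult.prems]]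
    by (simp only: of_real_mult mult.assoc)
qed

text \<open>By Stone-Weierstrass \<open>\<phi>\<close> is uniformly close to a real polynomial on
  the compact circle; the error in the integral is at most that distance times the L1 norm of
  \<open>f\<close>.\<close>

lemma fourier_null_integral_continuous:
  assumes f: "fourier_null f" and \<phi>: "continuous_on UNIV (\<phi> :: complex \<Rightarrow> real)"
  shows "(LINT \<zeta>|arc_length. f \<zeta> * of_real (\<phi> \<zeta>)) = 0"
proof -
  have int: "integrable arc_length f" using f by (simp add: fourier_null_def)
  have [measurable]: "f \<in> borel_measurable circle_borel"
    using borel_measurable_integrable[OF int] by simp
  define K where "K = (LINT \<zeta>|arc_length. cmod (f \<zeta>))"
  have "K \<ge> 0" by (simp add: K_def)
  have bnd: "cmod (LINT \<zeta>|arc_length. f \<zeta> * of_real (\<phi> \<zeta>)) \<le> e * K" if "e > 0" for e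
  proof -
    obtain p where p: "real_polynomial_function p" "\<And>\<zeta>. \<zeta> \<in> \<T> \<Longrightarrow> \<bar>\<phi> \<zeta> - p \<zeta>\<bar> < e"
      using Stone_Weierstrass_real_polynomial_function[OF compact_sphere continuous_on_subset[OF \<phi> subset_UNIV] \<open>e > 0\<close>, of 0 1] by blast
    have cp: "continuous_on UNIV p"
      using p(1) by (simp add: continuous_on_polymonial_function real_polynomial_function_eq)
    have [measurable]: "p \<in> borel_measurable circle_borel" "\<phi> \<in> borel_measurable circle_borel"
      using cp \<phi> by (auto intro!: borel_imp_circle_borel borel_measurable_continuous_onI)
    have "fourier_null (\<lambda>\<zeta>. f \<zeta> * of_real (p \<zeta>))"
      by (rule fourier_null_mult_polynomial) (use p f in auto)
    then have fp: "integrable arc_length (\<lambda>\<zeta>. f \<zeta> * of_real (p \<zeta>))"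
      "(LINT \<zeta>|arc_length. f \<zeta> * of_real (p \<zeta>)) = 0"
      by (auto simp: fourier_null_def dest: spec[of _ 0])
    have fd: "integrable arc_length (\<lambda>\<zeta>. f \<zeta> * of_real (\<phi> \<zeta> - p \<zeta>))"
      by (rule integrable_mult_bounded[OF int, where B = e])
         (use p(2) in \<open>auto simp: norm_of_real intro!: less_imp_le simp flip: of_real_diff\<close>)
    have "(LINT \<zeta>|arc_length. f \<zeta> * of_real (\<phi> \<zeta>))
        = (LINT \<zeta>|arc_length. f \<zeta> * of_real (p \<zeta>) + f \<zeta> * of_real (\<phi> \<zeta> - p \<zeta>))"
      by (simp add: algebra_simps)
    also have "\<dots> = (LINT \<zeta>|arc_length. f \<zeta> * of_real (\<phi> \<zeta> - p \<zeta>))"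
      using fp fd by (subst Bochner_Integration.integral_add) auto
    also have "cmod \<dots> \<le> (LINT \<zeta>|arc_length. cmod (f \<zeta> * of_real (\<phi> \<zeta> - p \<zeta>)))"
      by (rule integral_norm_bound)
    also have "\<dots> \<le> (LINT \<zeta>|arc_length. e * cmod (f \<zeta>))"
    proof (rule integral_mono)
      show "integrable arc_length (\<lambda>\<zeta>. cmod (f \<zeta> * of_real (\<phi> \<zeta> - p \<zeta>)))"
        using fd by (rule integrable_norm)
      show "integrable arc_length (\<lambda>\<zeta>. e * cmod (f \<zeta>))" using int by simp
      show "cmod (f \<zeta> * of_real (\<phi> \<zeta> - p \<zeta>)) \<le> e * cmod (f \<zeta>)" if "\<zeta> \<in> space arc_length" for \<zeta>
        using p(2)[of \<zeta>] that
        by (simp add: space_arc_length norm_mult mult.commute[of e] mult_left_mono less_imp_le flip: of_real_diff)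
    qed
    also have "\<dots> = e * K" by (simp add: K_def)
    finally show ?thesis .
  qed
  show ?thesis
  proof (rule ccontr)
    assume "\<not> ?thesis"
    then have pos: "cmod (LINT \<zeta>|arc_length. f \<zeta> * of_real (\<phi> \<zeta>)) > 0" (is "?c > 0") by simp
    \<comment> \<open>\<open>K + 1\<close> instead of \<open>K\<close>, since the L1 norm may be
      0.\<close>
    have "?c \<le> (?c / (2 * (K + 1))) * K" using bnd[of "?c / (2 * (K + 1))"] pos \<open>K \<ge> 0\<close> by simp
    also have "\<dots> \<le> ?c / 2" using pos \<open>K \<ge> 0\<close> by (simp add: field_simps)
    finally show False using pos by simp
  qed
qed

text \<open>The indicator of a nonempty closed set is the pointwise limit of continuous functions of
  the distance to it; \<open>cmod (f \<zeta>)\<close> dominates.\<close>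

lemma fourier_null_integral_closed:
  assumes f: "fourier_null f" and "closed A"
  shows "(LINT \<zeta>|arc_length. f \<zeta> * of_real (indicator A \<zeta>)) = 0"
proof (cases "A = {}")
  case False
  have int: "integrable arc_length f" using f by (simp add: fourier_null_def)
  have [measurable]: "f \<in> borel_measurable circle_borel"
    using borel_measurable_integrable[OF int] by simp
  define \<phi> where "\<phi> n \<zeta> = max 0 (1 - real n * infdist \<zeta> A)" for n \<zeta>
  have c: "continuous_on UNIV (\<phi> n)" for n
    unfolding \<phi>_def by (intro continuous_intros)
  have [measurable]: "\<phi> n \<in> borel_measurable circle_borel" for n
    using c by (auto intro!: borel_imp_circle_borel borel_measurable_continuous_onI)
  have [measurable]: "indicat_real A \<in> borel_measurable circle_borel"
    using \<open>closed A\<close> by (auto intro!: borel_imp_circle_borel)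
  have lim: "(\<lambda>n. \<phi> n \<zeta>) \<longlonglongrightarrow> indicator A \<zeta>" for \<zeta>
  proof (cases "\<zeta> \<in> A")
    case True
    then show ?thesis by (simp add: \<phi>_def)
  next
    case notin: False
    then have "infdist \<zeta> A > 0"
      using in_closed_iff_infdist_zero[OF \<open>closed A\<close> False, of \<zeta>] infdist_nonneg[of \<zeta> A] by simp
    moreover have "\<forall>\<^sub>F n in sequentially. max 0 (1 - real n * d) = 0" if "d > 0" for d
    proof -
      have "\<forall>\<^sub>F n in sequentially. real n \<ge> 1 / d"
        using filterlim_real_sequentially by (simp add: filterlim_at_top)
      then show ?thesis by eventually_elim (use that in \<open>simp add: field_simps\<close>)
    qed
    ultimately have "\<forall>\<^sub>F n in sequentially. \<phi> n \<zeta> = 0"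
      unfolding \<phi>_def by blast
    then show ?thesis using notin by (simp add: tendsto_eventually)
  qed
  have "(\<lambda>n. LINT \<zeta>|arc_length. f \<zeta> * of_real (\<phi> n \<zeta>)) \<longlonglongrightarrow> (LINT \<zeta>|arc_length. f \<zeta> * of_real (indicator A \<zeta>))"
  proof (rule integral_dominated_convergence[where w = "\<lambda>\<zeta>. cmod (f \<zeta>)"])
    show "AE \<zeta> in arc_length. cmod (f \<zeta> * of_real (\<phi> n \<zeta>)) \<le> cmod (f \<zeta>)" for n
    proof (rule AE_I2)
      fix \<zeta>
      have "\<bar>\<phi> n \<zeta>\<bar> \<le> 1" using infdist_nonneg[of \<zeta> A] by (simp add: \<phi>_def)
      then show "cmod (f \<zeta> * of_real (\<phi> n \<zeta>)) \<le> cmod (f \<zeta>)" by (simp add: norm_mult mult_left_le)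
    qed
    show "AE \<zeta> in arc_length. (\<lambda>n. f \<zeta> * of_real (\<phi> n \<zeta>)) \<longlonglongrightarrow> f \<zeta> * of_real (indicator A \<zeta>)"
      by (intro AE_I2 tendsto_intros lim)
  qed (use int in \<open>auto\<close>)
  then show ?thesis
    by (simp add: fourier_null_integral_continuous[OF f c] LIMSEQ_const_iff)
qed simp

text \<open>Closed sets form an intersection-stable generator of the Borel sets, so Dynkin's theorem
  carries the vanishing of the integrals from closed to all Borel sets.\<close>

proposition fourier_null_imp_AE_zero:
  assumes f: "fourier_null f"
  shows "AE \<zeta> in arc_length. f \<zeta> = 0"
proof -
  have int: "integrable arc_length f" using f by (simp add: fourier_null_def)
  have [measurable]: "f \<in> borel_measurable circle_borel"
    using borel_measurable_integrable[OF int] by simp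
  have ind [measurable]: "indicat_real A \<in> borel_measurable circle_borel" if "A \<in> sets borel" for A
    using that by (auto intro!: borel_imp_circle_borel)
  have intA: "integrable arc_length (\<lambda>\<zeta>. f \<zeta> * of_real (indicator A \<zeta>))" if "A \<in> sets borel" for A
    by (rule integrable_mult_bounded[OF int, where B = 1]) (use that in \<open>auto split: split_indicator\<close>)
  have zero: "(LINT \<zeta>|arc_length. f \<zeta> * of_real (indicator A \<zeta>)) = 0" if "A \<in> sets borel" for A
  proof -
    have "A \<in> sigma_sets UNIV (Collect closed)"
      using that by (simp add: borel_eq_closed)
    then show ?thesis
    proof (induction rule: sigma_sets_induct_disjoint[rotated 2, consumes 1, case_names basic empty compl union])
      case (basic A)
      then show ?case by (intro fourier_null_integral_closed f) auto
    next
      case empty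
      then show ?case by simp
    next
      case (compl A)
      then have "A \<in> sets borel" by (simp add: borel_eq_closed)
      have "(LINT \<zeta>|arc_length. f \<zeta> * of_real (indicator (UNIV - A) \<zeta>))
          = (LINT \<zeta>|arc_length. f \<zeta> - f \<zeta> * of_real (indicator A \<zeta>))"
        by (intro Bochner_Integration.integral_cong) (auto split: split_indicator)
      also have "\<dots> = (LINT \<zeta>|arc_length. f \<zeta>)"
        using compl int intA[OF \<open>A \<in> sets borel\<close>] by simp
      also have "\<dots> = 0" using f by (auto simp: fourier_null_def dest: spec[of _ 0])
      finally show ?case .
    next
      case (union A)
      then have A: "A i \<in> sets borel" for i by (auto simp: borel_eq_closed)
      then have Ai: "A i \<inter> \<T> \<in> sets arc_length" for i
        by (simp add: sets_arc_length Int_circle_in_sets)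
      have UnA: "(\<Union>i. A i \<inter> \<T>) \<in> sets arc_length"
        by (rule sets.countable_nat_UN) (use Ai in blast)
      have on_circle: "(LINT \<zeta>|arc_length. f \<zeta> * of_real (indicator B \<zeta>)) = (LINT \<zeta>:(B \<inter> \<T>)|arc_length. f \<zeta>)" for B
        unfolding set_lebesgue_integral_def
        by (rule Bochner_Integration.integral_cong) (simp_all add: space_arc_length indicator_def)
      have "(LINT \<zeta>:(\<Union>i. A i \<inter> \<T>)|arc_length. f \<zeta>) = (\<Sum>i. LINT \<zeta>:(A i \<inter> \<T>)|arc_length. f \<zeta>)"
      proof (rule lebesgue_integral_countable_add)
        show "set_integrable arc_length (\<Union>i. A i \<inter> \<T>) f"
          unfolding set_integrable_def by (rule integrable_mult_indicator[OF UnA int])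
        show "i \<noteq> j \<Longrightarrow> (A i \<inter> \<T>) \<inter> (A j \<inter> \<T>) = {}" for i j
          using union unfolding disjoint_family_on_def by blast
      qed (rule Ai)
      also have "\<dots> = 0" using union(3) by (simp add: on_circle)
      finally show ?case by (simp add: on_circle)
    qed (auto simp: Int_stable_def)
  qed
  show ?thesis
  proof (rule arc.density_zero[OF int])
    fix A assume "A \<in> sets arc_length"
    then obtain B where B: "B \<in> sets borel" "A = \<T> \<inter> B"
      by (auto simp: sets_arc_length circle_borel_def sets_restrict_space)
    have "(LINT \<zeta>:A|arc_length. f \<zeta>) = (LINT \<zeta>|arc_length. f \<zeta> * of_real (indicator B \<zeta>))"
      unfolding set_lebesgue_integral_def B
      by (rule Bochner_Integration.integral_cong) (simp_all add: space_arc_length indicator_def)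
    then show "(LINT \<zeta>:A|arc_length. f \<zeta>) = 0" using zero[OF B(1)] by simp
  qed
qed

subsection \<open>Poisson extension near a point of finite local Dirichlet integral\<close>

text \<open>Absolute summability permits exchanging sum and integral. The sign \<open>s = -1\<close>
  serves the Poisson kernel, \<open>s = 1\<close> the functions \<open>peak n\<close>.\<close>

lemma integral_powi_series:
  fixes s :: int
  assumes f: "integrable arc_length f" and g: "summable (\<lambda>k. cmod (g k))"
  shows "(LINT \<zeta>|arc_length. f \<zeta> * (\<Sum>k. g k * \<zeta> powi (s * int k)))
       = (\<Sum>k. g k * (LINT \<zeta>|arc_length. f \<zeta> * \<zeta> powi (s * int k)))"
proof -
  have [measurable]: "f \<in> borel_measurable circle_borel"
    using borel_measurable_integrable[OF f] by simp
  have norm: "cmod (g k * (f \<zeta> * \<zeta> powi (s * int k))) = cmod (g k) * cmod (f \<zeta>)" if "\<zeta> \<in> \<T>" for k \<zeta>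
    using norm_powi_circle[OF that] by (simp add: norm_mult)
  have sg: "summable (\<lambda>k. g k * \<zeta> powi (s * int k))" if "\<zeta> \<in> \<T>" for \<zeta>
    by (rule summable_norm_cancel) (use g norm_powi_circle[OF that] in \<open>simp add: norm_mult\<close>)
  have "(LINT \<zeta>|arc_length. f \<zeta> * (\<Sum>k. g k * \<zeta> powi (s * int k)))
      = (LINT \<zeta>|arc_length. (\<Sum>k. g k * (f \<zeta> * \<zeta> powi (s * int k))))"
  proof (rule Bochner_Integration.integral_cong)
    fix \<zeta> assume "\<zeta> \<in> space arc_length"
    then show "f \<zeta> * (\<Sum>k. g k * \<zeta> powi (s * int k)) = (\<Sum>k. g k * (f \<zeta> * \<zeta> powi (s * int k)))"
      using suminf_mult[OF sg, of \<zeta> "f \<zeta>"] by (simp add: space_arc_length mult.left_commute)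
  qed simp
  also have "\<dots> = (\<Sum>k. LINT \<zeta>|arc_length. g k * (f \<zeta> * \<zeta> powi (s * int k)))"
  proof (rule integral_suminf)
    show "integrable arc_length (\<lambda>\<zeta>. g k * (f \<zeta> * \<zeta> powi (s * int k)))" for k
      by (intro integrable_mult_right integrable_mult_powi f)
    show "AE \<zeta> in arc_length. summable (\<lambda>k. cmod (g k * (f \<zeta> * \<zeta> powi (s * int k))))"
    proof (rule AE_I2)
      fix \<zeta> assume "\<zeta> \<in> space arc_length"
      then show "summable (\<lambda>k. cmod (g k * (f \<zeta> * \<zeta> powi (s * int k))))"
        by (simp only: space_arc_length norm) (rule summable_mult2[OF g])
    qed
    have "(LINT \<zeta>|arc_length. cmod (g k * (f \<zeta> * \<zeta> powi (s * int k)))) = cmod (g k) * (LINT \<zeta>|arc_length. cmod (f \<zeta>))" for k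
    proof -
      have "(LINT \<zeta>|arc_length. cmod (g k * (f \<zeta> * \<zeta> powi (s * int k)))) = (LINT \<zeta>|arc_length. cmod (g k) * cmod (f \<zeta>))"
        by (rule Bochner_Integration.integral_cong) (simp_all only: space_arc_length norm)
      then show ?thesis by simp
    qed
    then show "summable (\<lambda>k. LINT \<zeta>|arc_length. cmod (g k * (f \<zeta> * \<zeta> powi (s * int k))))"
      using summable_mult2[OF g] by simp
  qed
  also have "\<dots> = (\<Sum>k. g k * (LINT \<zeta>|arc_length. f \<zeta> * \<zeta> powi (s * int k)))"
    by simp
  finally show ?thesis .
qed

section \<open>The Poisson kernel: bounds and total mass\<close>

definition poisson_kernel :: "complex \<Rightarrow> complex \<Rightarrow> real" where
  "poisson_kernel z \<zeta> = (1 - (cmod z)\<^sup>2) / (cmod (\<zeta> - z))\<^sup>2"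

lemma poisson_ext_eq: "poisson_ext f z = (LINT \<zeta>|arc_length. poisson_kernel z \<zeta> *\<^sub>R f \<zeta>)"
  by (simp add: poisson_ext_def poisson_kernel_def)

lemma measurable_poisson_kernel [measurable]: "poisson_kernel z \<in> borel_measurable circle_borel"
  unfolding poisson_kernel_def by measurable

lemma one_minus_cmod_le:
  assumes "\<zeta> \<in> \<T>" shows "1 - cmod z \<le> cmod (\<zeta> - z)"
  using norm_triangle_ineq2[of \<zeta> z] assms by simp

lemma poisson_kernel_nonneg: "cmod z < 1 \<Longrightarrow> 0 \<le> poisson_kernel z \<zeta>"
  by (simp add: poisson_kernel_def power_le_one)

lemma poisson_kernel_le:
  assumes "cmod z < 1" "\<zeta> \<in> \<T>"
  shows "poisson_kernel z \<zeta> \<le> 1 / (1 - cmod z)\<^sup>2"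
proof -
  have "(1 - cmod z)\<^sup>2 \<le> (cmod (\<zeta> - z))\<^sup>2"
    using one_minus_cmod_le[of \<zeta> z] assms by (intro power_mono) auto
  then show ?thesis
    unfolding poisson_kernel_def using assms by (intro frac_le) auto
qed

text \<open>Used twice: to write the Poisson kernel as the real part of a geometric series, and to
  compute the modulus of \<open>peak n\<close>.\<close>

lemma Re_cayley: "Re ((1 + u) / (1 - u)) = (1 - (cmod u)\<^sup>2) / (cmod (1 - u))\<^sup>2"
proof -
  have "(1 + u) / (1 - u) = (1 + u) * cnj (1 - u) / (cmod (1 - u))\<^sup>2"
    by (rule complex_div_cnj)
  moreover have "Re ((1 + u) * cnj (1 - u)) = 1 - (cmod u)\<^sup>2"
    unfolding cmod_power2 by (simp add: algebra_simps power2_eq_square)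
  ultimately show ?thesis by simp
qed

text \<open>On the circle the kernel is \<open>Re (2 * h - 1)\<close>, where \<open>h\<close> is the
  geometric series in \<open>z / \<zeta>\<close>; all terms of \<open>h\<close> but the constant one
  integrate to 0.\<close>

lemma integral_poisson_kernel:
  assumes "cmod z < 1"
  shows "integrable arc_length (poisson_kernel z)" "(LINT \<zeta>|arc_length. poisson_kernel z \<zeta>) = 1"
proof -
  show "integrable arc_length (poisson_kernel z)"
    by (rule arc.integrable_const_bound[where B = "1 / (1 - cmod z)\<^sup>2"])
       (auto intro!: AE_I2 simp: space_arc_length assms poisson_kernel_nonneg poisson_kernel_le)
  define h where "h \<zeta> = (\<Sum>k. z ^ k * \<zeta> powi (- 1 * int k))" for \<zeta>
  have sz: "summable (\<lambda>k. cmod (z ^ k))"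
    using assms by (simp add: norm_power)
  have one: "integrable arc_length (\<lambda>_. 1 :: complex)" by simp
  have "(LINT \<zeta>|arc_length. 1 * h \<zeta>) = (\<Sum>k. z ^ k * (LINT \<zeta>|arc_length. 1 * \<zeta> powi (- 1 * int k)))"
    unfolding h_def by (rule integral_powi_series[OF one sz])
  also have "\<dots> = (\<Sum>k. if k = 0 then 1 else 0)"
    by (intro suminf_cong) (simp add: integral_powi del: power_int_minus)
  also have "\<dots> = 1" using sums_single[of 0 "\<lambda>_. 1 :: complex"] by (simp add: sums_iff)
  finally have int_h: "(LINT \<zeta>|arc_length. h \<zeta>) = 1" by simp
  have h: "h \<zeta> = 1 / (1 - z / \<zeta>)" if "\<zeta> \<in> \<T>" for \<zeta>
  proof -
    have "\<zeta> \<noteq> 0" using that by auto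
    have "z ^ k * \<zeta> powi (- 1 * int k) = (z / \<zeta>) ^ k" for k
      by (simp add: power_int_minus power_divide divide_inverse power_inverse power_mult_distrib)
    moreover have "cmod (z / \<zeta>) < 1" using that assms by (simp add: norm_divide)
    ultimately show ?thesis by (simp add: h_def suminf_geometric)
  qed
  have P: "poisson_kernel z \<zeta> = Re (2 * h \<zeta> - 1)" if "\<zeta> \<in> \<T>" for \<zeta>
  proof -
    have "\<zeta> \<noteq> 0" "cmod \<zeta> = 1" using that by auto
    have "cmod (z / \<zeta>) < 1" using that assms by (simp add: norm_divide)
    then have "1 - z / \<zeta> \<noteq> 0" by auto
    then have "2 * h \<zeta> - 1 = (1 + z / \<zeta>) / (1 - z / \<zeta>)"
      unfolding h[OF that] by (simp add: divide_simps)
    moreover have "cmod (1 - z / \<zeta>) = cmod (\<zeta> - z)"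
      using \<open>\<zeta> \<noteq> 0\<close> \<open>cmod \<zeta> = 1\<close> by (simp add: diff_divide_eq_iff norm_divide)
    ultimately show ?thesis
      using Re_cayley[of "z / \<zeta>"] \<open>cmod \<zeta> = 1\<close> by (simp add: poisson_kernel_def norm_divide)
  qed
  \<comment> \<open>A nonintegrable function has Bochner integral 0 by convention, whereas the
    integral of \<open>h\<close> was found to be 1.\<close>
  have inth: "integrable arc_length h"
  proof (rule ccontr)
    assume "\<not> ?thesis"
    then show False using int_h by (simp add: not_integrable_integral_eq)
  qed
  have "(LINT \<zeta>|arc_length. poisson_kernel z \<zeta>) = (LINT \<zeta>|arc_length. Re (2 * h \<zeta> - 1))"
    by (rule Bochner_Integration.integral_cong) (simp_all only: space_arc_length P)
  also have "\<dots> = Re (LINT \<zeta>|arc_length. 2 * h \<zeta> - 1)"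
    by (rule integral_Re) (use inth in simp)
  also have "(LINT \<zeta>|arc_length. 2 * h \<zeta> - 1) = 2 * (LINT \<zeta>|arc_length. h \<zeta>) - 1"
    using inth arc.prob_space by simp
  finally show "(LINT \<zeta>|arc_length. poisson_kernel z \<zeta>) = 1"
    by (simp add: int_h)
qed

lemma L2_circle_integrable:
  assumes "f \<in> L2_circle" shows "integrable arc_length f"
proof (rule integrableI_bounded)
  show f: "f \<in> borel_measurable arc_length" using assms by (simp add: L2_circle_def)
  then have [measurable]: "f \<in> borel_measurable circle_borel" by simp
  have "(\<integral>\<^sup>+\<zeta>. ennreal (cmod (f \<zeta>)) * 1 \<partial>arc_length)\<^sup>2
      \<le> (\<integral>\<^sup>+\<zeta>. (ennreal (cmod (f \<zeta>)))\<^sup>2 \<partial>arc_length) * (\<integral>\<^sup>+\<zeta>. 1\<^sup>2 \<partial>arc_length)"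
    by (rule Cauchy_Schwarz_nn_integral) auto
  also have "\<dots> = L2_norm_sq f"
    by (simp add: L2_norm_sq_def ennreal_power arc.emeasure_space_1)
  also have "\<dots> < \<infinity>" using assms by (simp add: L2_circle_def)
  finally show "(\<integral>\<^sup>+\<zeta>. ennreal (cmod (f \<zeta>)) \<partial>arc_length) < \<infinity>"
    by (simp add: power_less_top_ennreal)
qed

text \<open>The integral of \<open>local_dirichlet\<close> freed from its case distinction, with the
  boundary value as a parameter.\<close>

definition diff_quot_sq :: "(complex \<Rightarrow> complex) \<Rightarrow> complex \<Rightarrow> complex \<Rightarrow> ennreal" where
  "diff_quot_sq f a v = (\<integral>\<^sup>+\<zeta>. ennreal ((cmod ((f \<zeta> - v) / (\<zeta> - a)))\<^sup>2) \<partial>arc_length)"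

text \<open>Cauchy--Schwarz against the Poisson kernel, which absorbs the factor
  \<open>|\<zeta> - a|\<^sup>2\<close> because \<open>|\<zeta> - a| \<le> 3 |\<zeta> - z|\<close> on the circle.\<close>

lemma poisson_ext_near:
  assumes f: "integrable arc_length f" and "cmod z < 1" and az: "cmod (a - z) \<le> 2 * (1 - cmod z)"
  shows "ennreal ((cmod (poisson_ext f z - v))\<^sup>2) \<le> ennreal (18 * (1 - cmod z)) * diff_quot_sq f a v"
proof -
  let ?P = "poisson_kernel z"
  have [measurable]: "f \<in> borel_measurable circle_borel"
    using borel_measurable_integrable[OF f] by simp
  have P0: "0 \<le> ?P \<zeta>" for \<zeta> using assms by (intro poisson_kernel_nonneg)
  note intP = integral_poisson_kernel[OF \<open>cmod z < 1\<close>]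
  have intPf: "integrable arc_length (\<lambda>\<zeta>. ?P \<zeta> *\<^sub>R f \<zeta>)"
  proof -
    have "integrable arc_length (\<lambda>\<zeta>. f \<zeta> * of_real (?P \<zeta>))"
      by (rule integrable_mult_bounded[OF f, where B = "1 / (1 - cmod z)\<^sup>2"])
         (use assms poisson_kernel_le poisson_kernel_nonneg in auto)
    then show ?thesis by (simp add: scaleR_conv_of_real mult.commute)
  qed
  have intPv: "integrable arc_length (\<lambda>\<zeta>. ?P \<zeta> *\<^sub>R v)"
    using intP(1) by (rule integrable_scaleR_left[rotated])
  have int: "integrable arc_length (\<lambda>\<zeta>. ?P \<zeta> *\<^sub>R (f \<zeta> - v))"
    using intPf intPv by (simp add: scaleR_diff_right)
  have "(LINT \<zeta>|arc_length. ?P \<zeta> *\<^sub>R (f \<zeta> - v)) = poisson_ext f z - v"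
    using intPf intPv intP by (simp add: scaleR_diff_right poisson_ext_eq)
  then have "ennreal (cmod (poisson_ext f z - v)) \<le> (\<integral>\<^sup>+\<zeta>. cmod (?P \<zeta> *\<^sub>R (f \<zeta> - v)) \<partial>arc_length)"
    using integral_norm_bound_ennreal[OF int] by simp
  also have "\<dots> = (\<integral>\<^sup>+\<zeta>. ennreal (?P \<zeta> * cmod (\<zeta> - a)) * ennreal (cmod ((f \<zeta> - v) / (\<zeta> - a))) \<partial>arc_length)"
  proof (rule nn_integral_cong_AE)
    show "AE \<zeta> in arc_length. ennreal (cmod (?P \<zeta> *\<^sub>R (f \<zeta> - v)))
        = ennreal (?P \<zeta> * cmod (\<zeta> - a)) * ennreal (cmod ((f \<zeta> - v) / (\<zeta> - a)))"
      using AE_arc_length_neq[of a]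
    proof eventually_elim
      case (elim \<zeta>)
      then show ?case using P0[of \<zeta>] by (simp add: norm_divide flip: ennreal_mult)
    qed
  qed
  finally have "(ennreal (cmod (poisson_ext f z - v)))\<^sup>2 \<le>
      (\<integral>\<^sup>+\<zeta>. ennreal (?P \<zeta> * cmod (\<zeta> - a)) * ennreal (cmod ((f \<zeta> - v) / (\<zeta> - a))) \<partial>arc_length)\<^sup>2"
    by (rule power_mono) simp
  also have "\<dots> \<le> (\<integral>\<^sup>+\<zeta>. (ennreal (?P \<zeta> * cmod (\<zeta> - a)))\<^sup>2 \<partial>arc_length) *
      (\<integral>\<^sup>+\<zeta>. (ennreal (cmod ((f \<zeta> - v) / (\<zeta> - a))))\<^sup>2 \<partial>arc_length)"
    by (rule Cauchy_Schwarz_nn_integral) measurable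
  also have "(\<integral>\<^sup>+\<zeta>. (ennreal (cmod ((f \<zeta> - v) / (\<zeta> - a))))\<^sup>2 \<partial>arc_length) = diff_quot_sq f a v"
    by (simp add: diff_quot_sq_def ennreal_power)
  also have "(\<integral>\<^sup>+\<zeta>. (ennreal (?P \<zeta> * cmod (\<zeta> - a)))\<^sup>2 \<partial>arc_length)
      \<le> (\<integral>\<^sup>+\<zeta>. ennreal (18 * (1 - cmod z)) * ennreal (?P \<zeta>) \<partial>arc_length)"
  proof (rule nn_integral_mono)
    fix \<zeta> assume "\<zeta> \<in> space arc_length"
    then have "\<zeta> \<in> \<T>" by (simp add: space_arc_length)
    let ?d = "cmod (\<zeta> - z)"
    have d: "1 - cmod z \<le> ?d" using \<open>\<zeta> \<in> \<T>\<close> by (rule one_minus_cmod_le)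
    then have "?d > 0" using assms by linarith
    have "cmod (\<zeta> - a) \<le> ?d + cmod (a - z)"
      using norm_triangle_ineq4[of "\<zeta> - z" "a - z"] by simp
    then have "cmod (\<zeta> - a) \<le> 3 * ?d" using d az by argo
    then have "(cmod (\<zeta> - a))\<^sup>2 \<le> (3 * ?d)\<^sup>2" by (intro power_mono) auto
    then have "(cmod (\<zeta> - a))\<^sup>2 \<le> 9 * ?d\<^sup>2" by (simp add: power_mult_distrib)
    then have "(1 - (cmod z)\<^sup>2) * (cmod (\<zeta> - a))\<^sup>2 \<le> (1 - (cmod z)\<^sup>2) * (9 * ?d\<^sup>2)"
      using assms by (intro mult_left_mono) (auto simp: power_le_one)
    then have "?P \<zeta> * (cmod (\<zeta> - a))\<^sup>2 \<le> 9 * (1 - (cmod z)\<^sup>2)"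
      using \<open>?d > 0\<close> by (simp add: poisson_kernel_def field_simps)
    \<comment> \<open>Expanding \<open>(1 - cmod z)\<^sup>2 \<ge> 0\<close> gives
      \<open>1 - (cmod z)\<^sup>2 \<le> 2 * (1 - cmod z)\<close>.\<close>
    also have "\<dots> \<le> 18 * (1 - cmod z)"
      using zero_le_power2[of "1 - cmod z"] by (simp add: power2_diff)
    finally have "?P \<zeta> * (?P \<zeta> * (cmod (\<zeta> - a))\<^sup>2) \<le> ?P \<zeta> * (18 * (1 - cmod z))"
      by (rule mult_left_mono[OF _ P0])
    then have "(?P \<zeta> * cmod (\<zeta> - a))\<^sup>2 \<le> 18 * (1 - cmod z) * ?P \<zeta>"
      by (simp add: power2_eq_square mult.assoc mult.commute mult.left_commute)
    then show "(ennreal (?P \<zeta> * cmod (\<zeta> - a)))\<^sup>2 \<le> ennreal (18 * (1 - cmod z)) * ennreal (?P \<zeta>)"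
      using P0[of \<zeta>] assms by (simp add: ennreal_power flip: ennreal_mult)
  qed
  also have "\<dots> = ennreal (18 * (1 - cmod z))"
    using P0 intP by (simp add: nn_integral_cmult nn_integral_eq_integral)
  finally show ?thesis by (simp add: ennreal_power mult_right_mono)
qed

subsection \<open>Analytic functions that are small near \<open>1\<close>\<close>

text \<open>The Cayley transform of \<open>r * z\<close> with \<open>r = n / (n + 1)\<close>, scaled
  by \<open>n + 1\<close> and exponentiated. As \<open>r < 1\<close>, it is holomorphic beyond the
  closed disc, while its value \<open>exp (n + 1)\<close> at 0 is unbounded in
  \<open>n\<close>.\<close>

definition peak :: "nat \<Rightarrow> complex \<Rightarrow> complex" where
  "peak n z = exp (of_nat (Suc n) * (1 + of_real (n / Suc n) * z) / (1 - of_real (n / Suc n) * z))"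

lemma peak_powser:
  obtains g where "summable (\<lambda>k. cmod (g k))" "g 0 = exp (of_nat (Suc n))"
    "\<And>\<zeta>. \<zeta> \<in> \<T> \<Longrightarrow> peak n \<zeta> = (\<Sum>k. g k * \<zeta> powi int k)"
proof -
  define r where "r = real n / Suc n"
  \<comment> \<open>Chosen with \<open>1 < R\<close> and \<open>r * R < 1\<close>, because
    \<open>n * (n + 2) < (n + 1)\<^sup>2\<close>; the disc of radius \<open>R\<close> then misses
    the pole.\<close>
  define R where "R = (real n + 2) / Suc n"
  have "real n * (real n + 2) < real (Suc n) * real (Suc n)"
    by (simp add: algebra_simps)
  then have "r * R < 1"
    unfolding r_def R_def times_divide_times_eq by (subst pos_divide_less_eq) auto
  moreover have "0 \<le> r" and R: "R > 1"
    by (auto simp: r_def R_def field_simps)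
  ultimately have r: "0 \<le> r" "r * R < 1" by auto
  have ne: "1 - of_real r * z \<noteq> 0" if "z \<in> ball 0 R" for z :: complex
  proof
    assume "1 - of_real r * z = 0"
    then have "cmod (of_real r * z) = 1" by simp
    moreover have "r * cmod z \<le> r * R" using that r by (intro mult_left_mono) auto
    ultimately show False using r by (simp add: norm_mult)
  qed
  have hol: "peak n holomorphic_on ball 0 R"
    unfolding peak_def r_def[symmetric] using ne by (intro holomorphic_intros) auto
  define g where "g k = (deriv ^^ k) (peak n) 0 / fact k" for k
  have sums: "(\<lambda>k. g k * z ^ k) sums peak n z" if "cmod z < R" for z
    using holomorphic_power_series[OF hol, of z] that by (simp add: g_def)
  show thesis
  proof
    \<comment> \<open>Convergence at a radius strictly between 1 and \<open>R\<close> yields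
      absolute convergence at 1.\<close>
    have "summable (\<lambda>k. g k * of_real ((1 + R) / 2) ^ k)"
      using sums[of "of_real ((1 + R) / 2)"] R by (simp add: sums_iff norm_of_real del: of_real_divide of_real_add)
    then have "summable (\<lambda>k. cmod (g k * 1 ^ k))"
      by (rule powser_insidea) (use R in \<open>simp add: norm_of_real del: of_real_divide of_real_add\<close>)
    then show "summable (\<lambda>k. cmod (g k))" by simp
    show "g 0 = exp (of_nat (Suc n))" by (simp add: g_def peak_def)
    show "peak n \<zeta> = (\<Sum>k. g k * \<zeta> powi int k)" if "\<zeta> \<in> \<T>" for \<zeta>
      using sums[of \<zeta>] that R by (simp add: sums_iff)
  qed
qed

lemma measurable_peak [measurable]: "peak n \<in> borel_measurable circle_borel"
  unfolding peak_def by measurable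

text \<open>With \<open>r = n / (n + 1)\<close> the Poisson kernel \<open>(1 - r\<^sup>2) / |1 - r \<zeta>|\<^sup>2\<close> is at most
  \<open>8 / ((n + 1) |1 - \<zeta>|\<^sup>2)\<close>, so the factor \<open>n + 1\<close> in the exponent is compensated
  away from \<open>1\<close>.\<close>

lemma peak_le:
  assumes "\<zeta> \<in> \<T>" "\<zeta> \<noteq> 1"
  shows "(cmod (peak n \<zeta>))\<^sup>2 \<le> exp (16 / (cmod (1 - \<zeta>))\<^sup>2)"
proof -
  define r where "r = real n / Suc n"
  have r: "0 \<le> r" "r < 1" and N: "Suc n * (1 - r) = 1"
    by (auto simp: r_def field_simps)
  define u where "u = of_real r * \<zeta>"
  have u: "cmod u = r" using assms r by (simp add: u_def norm_mult)
  have d: "cmod (1 - \<zeta>) > 0" using assms by auto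
  have "1 - r \<le> cmod (1 - u)"
    using norm_triangle_ineq2[of 1 u] u by simp
  then have du: "cmod (1 - u) > 0" using r by linarith
  have "1 - \<zeta> = (1 - u) - of_real (1 - r) * \<zeta>" by (simp add: u_def algebra_simps)
  then have "cmod (1 - \<zeta>) \<le> cmod (1 - u) + cmod (of_real (1 - r) * \<zeta>)"
    by (metis norm_triangle_ineq4)
  also have "cmod (of_real (1 - r) * \<zeta>) = 1 - r"
    using assms r unfolding norm_mult norm_of_real by simp
  finally have "cmod (1 - \<zeta>) \<le> 2 * cmod (1 - u)"
    using \<open>1 - r \<le> cmod (1 - u)\<close> by linarith
  then have "(cmod (1 - \<zeta>))\<^sup>2 \<le> (2 * cmod (1 - u))\<^sup>2" by (intro power_mono) auto
  then have "(cmod (1 - \<zeta>))\<^sup>2 \<le> 4 * (cmod (1 - u))\<^sup>2" by (simp add: power_mult_distrib)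
  then have 1: "2 / (cmod (1 - u))\<^sup>2 \<le> 8 / (cmod (1 - \<zeta>))\<^sup>2"
    using d du by (simp add: field_simps)
  have "real (Suc n) * (1 - r\<^sup>2) = Suc n * (1 - r) * (1 + r)"
    by (simp add: power2_eq_square algebra_simps)
  also have "\<dots> \<le> 2" using N r by simp
  finally have 2: "Suc n * (1 - r\<^sup>2) / (cmod (1 - u))\<^sup>2 \<le> 2 / (cmod (1 - u))\<^sup>2"
    by (rule divide_right_mono) simp
  have "peak n \<zeta> = exp (of_real (Suc n) * ((1 + u) / (1 - u)))"
    by (simp add: peak_def u_def r_def)
  then have "cmod (peak n \<zeta>) = exp (Suc n * Re ((1 + u) / (1 - u)))"
    by (simp only: norm_exp_eq_Re Re_complex_of_real times_complex.sel Im_complex_of_real mult_zero_left diff_0_right)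
  also have "Re ((1 + u) / (1 - u)) = (1 - r\<^sup>2) / (cmod (1 - u))\<^sup>2"
    by (simp only: Re_cayley u)
  finally have "cmod (peak n \<zeta>) \<le> exp (8 / (cmod (1 - \<zeta>))\<^sup>2)"
    using 1 2 by simp
  then have "(cmod (peak n \<zeta>))\<^sup>2 \<le> (exp (8 / (cmod (1 - \<zeta>))\<^sup>2))\<^sup>2"
    by (intro power_mono) auto
  also have "\<dots> = exp (16 / (cmod (1 - \<zeta>))\<^sup>2)"
    by (simp add: exp_double[symmetric])
  finally show ?thesis .
qed

text \<open>Integrating \<open>f * \<zeta> powi (- m)\<close> against \<open>peak n\<close> kills
  every term of the power series but the constant one, leaving \<open>exp (n + 1)\<close> times the
  m-th coefficient. By Cauchy-Schwarz and \<open>peak_le\<close> this is bounded independently of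
  \<open>n\<close>.\<close>

lemma fourier_coeff_eq_zero:
  assumes f: "integrable arc_length f"
    and below: "\<And>j. j < m \<Longrightarrow> fourier_coeff f j = 0"
    and W: "(\<integral>\<^sup>+\<zeta>. ennreal ((cmod (f \<zeta>))\<^sup>2 * exp (16 / (cmod (1 - \<zeta>))\<^sup>2)) \<partial>arc_length) < \<infinity>"
      (is "?K < \<infinity>")
  shows "fourier_coeff f m = 0"
proof -
  have [measurable]: "f \<in> borel_measurable circle_borel"
    using borel_measurable_integrable[OF f] by simp
  define F where "F \<zeta> = f \<zeta> * \<zeta> powi (- m)" for \<zeta>
  have F: "integrable arc_length F"
    unfolding F_def by (intro integrable_mult_powi f)
  have [measurable]: "F \<in> borel_measurable circle_borel"
    using borel_measurable_integrable[OF F] by simp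
  have FK: "(LINT \<zeta>|arc_length. F \<zeta> * \<zeta> powi int k) = fourier_coeff f (m - int k)" for k
    unfolding fourier_coeff_def
  proof (rule Bochner_Integration.integral_cong)
    fix \<zeta> assume "\<zeta> \<in> space arc_length"
    then have "\<zeta> powi (- (m - int k)) = \<zeta> powi (- m) * \<zeta> powi int k"
      using circle_powi_add[of \<zeta> "- m" "int k"] by (simp add: space_arc_length)
    then show "F \<zeta> * \<zeta> powi int k = f \<zeta> * \<zeta> powi (- (m - int k))"
      by (simp only: F_def mult.assoc)
  qed simp
  have bound: "ennreal ((exp (Suc n) * cmod (fourier_coeff f m))\<^sup>2) \<le> ?K" for n
  proof -
    obtain g where g: "summable (\<lambda>k. cmod (g k))" "g 0 = exp (of_nat (Suc n))"
      "\<And>\<zeta>. \<zeta> \<in> \<T> \<Longrightarrow> peak n \<zeta> = (\<Sum>k. g k * \<zeta> powi int k)"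
      using peak_powser[of n] by blast
    have "(LINT \<zeta>|arc_length. F \<zeta> * peak n \<zeta>) = (LINT \<zeta>|arc_length. F \<zeta> * (\<Sum>k. g k * \<zeta> powi (1 * int k)))"
      by (rule Bochner_Integration.integral_cong) (simp_all only: space_arc_length g(3) mult_1)
    also have "\<dots> = (\<Sum>k. g k * fourier_coeff f (m - int k))"
      by (subst integral_powi_series[OF F g(1)]) (simp only: FK mult_1)
    also have "\<dots> = (\<Sum>k\<in>{0}. g k * fourier_coeff f (m - int k))"
      by (rule suminf_finite) (auto simp: below)
    finally have eq: "(LINT \<zeta>|arc_length. F \<zeta> * peak n \<zeta>) = exp (of_nat (Suc n)) * fourier_coeff f m"
      by (simp add: g(2))
    have "exp (real (Suc n)) * cmod (fourier_coeff f m) = cmod (LINT \<zeta>|arc_length. F \<zeta> * peak n \<zeta>)"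
      unfolding eq norm_mult norm_exp_eq_Re by simp
    also have "ennreal \<dots> \<le> (\<integral>\<^sup>+\<zeta>. ennreal (cmod (F \<zeta> * peak n \<zeta>)) * 1 \<partial>arc_length)"
    proof (cases "integrable arc_length (\<lambda>\<zeta>. F \<zeta> * peak n \<zeta>)")
      case True
      then show ?thesis using integral_norm_bound_ennreal by fastforce
    next
      \<comment> \<open>The integral on the left is then 0 by convention.\<close>
      case False
      then show ?thesis by (simp add: not_integrable_integral_eq)
    qed
    finally have "(ennreal (exp (real (Suc n)) * cmod (fourier_coeff f m)))\<^sup>2
        \<le> (\<integral>\<^sup>+\<zeta>. ennreal (cmod (F \<zeta> * peak n \<zeta>)) * 1 \<partial>arc_length)\<^sup>2"
      by (rule power_mono) simp
    also have "\<dots> \<le> (\<integral>\<^sup>+\<zeta>. (ennreal (cmod (F \<zeta> * peak n \<zeta>)))\<^sup>2 \<partial>arc_length) * (\<integral>\<^sup>+\<zeta>. 1\<^sup>2 \<partial>arc_length)"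
      by (rule Cauchy_Schwarz_nn_integral) measurable
    also have "\<dots> = (\<integral>\<^sup>+\<zeta>. (ennreal (cmod (F \<zeta> * peak n \<zeta>)))\<^sup>2 \<partial>arc_length)"
      by (simp add: arc.emeasure_space_1)
    also have "\<dots> \<le> ?K"
    proof (rule nn_integral_mono_AE)
      show "AE \<zeta> in arc_length. (ennreal (cmod (F \<zeta> * peak n \<zeta>)))\<^sup>2
          \<le> ennreal ((cmod (f \<zeta>))\<^sup>2 * exp (16 / (cmod (1 - \<zeta>))\<^sup>2))"
        using AE_arc_length_neq[of 1] AE_space
      proof eventually_elim
        case (elim \<zeta>)
        then have "\<zeta> \<in> \<T>" by (simp add: space_arc_length)
        then have "cmod (F \<zeta> * peak n \<zeta>) = cmod (f \<zeta>) * cmod (peak n \<zeta>)"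
          using norm_powi_circle[of \<zeta> "- m"] unfolding F_def norm_mult by simp
        then show ?case
          using peak_le[OF \<open>\<zeta> \<in> \<T>\<close> elim(1), of n]
          by (simp add: ennreal_power power_mult_distrib mult_left_mono)
      qed
    qed
    finally show ?thesis by (simp add: ennreal_power)
  qed
  show ?thesis
  proof (rule ccontr)
    assume "fourier_coeff f m \<noteq> 0"
    then have c: "cmod (fourier_coeff f m) > 0" (is "?c > 0") by simp
    obtain K where K: "?K = ennreal K" "K \<ge> 0" using W by (cases ?K) auto
    have *: "(exp (Suc n) * ?c)\<^sup>2 \<le> K" for n
      using bound[of n] K by simp
    obtain n where n: "real n > (K + 1) / ?c" using reals_Archimedean2 by blast
    have "exp (real (Suc n)) \<ge> real n"
      using exp_ge_add_one_self[of "real (Suc n)"] by simp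
    then have "exp (Suc n) * ?c \<ge> real n * ?c" using c by (intro mult_right_mono) auto
    moreover have "real n * ?c > K + 1" using n c by (simp add: field_simps)
    ultimately have "exp (Suc n) * ?c > K + 1" by linarith
    then have "(exp (Suc n) * ?c)\<^sup>2 > (K + 1)\<^sup>2" using K by (intro power_strict_mono) auto
    moreover have "(K + 1)\<^sup>2 \<ge> K" using K by (simp add: power2_eq_square algebra_simps)
    ultimately show False using *[of n] by simp
  qed
qed

text \<open>Strong induction kills the nonnegative coefficients one after the other, starting from
  the vanishing of the negative ones.\<close>

proposition analytic_AE_zero_if_weighted_L2:
  assumes f: "integrable arc_length f" and neg: "\<And>j. j < 0 \<Longrightarrow> fourier_coeff f j = 0"
    and W: "(\<integral>\<^sup>+\<zeta>. ennreal ((cmod (f \<zeta>))\<^sup>2 * exp (16 / (cmod (1 - \<zeta>))\<^sup>2)) \<partial>arc_length) < \<infinity>"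
  shows "AE \<zeta> in arc_length. f \<zeta> = 0"
proof -
  have "fourier_coeff f (int m) = 0" for m
  proof (induction m rule: less_induct)
    case (less m)
    show ?case
    proof (rule fourier_coeff_eq_zero[OF f _ W])
      fix j assume "j < int m"
      then show "fourier_coeff f j = 0"
        using neg[of j] less[of "nat j"] by (cases "j < 0") auto
    qed
  qed
  then have "fourier_coeff f j = 0" for j
    using neg[of j] by (cases "j < 0") (auto dest: spec[of _ "nat j"] simp: not_less elim: nonneg_int_cases)
  then have "(LINT \<zeta>|arc_length. f \<zeta> * \<zeta> powi k) = 0" for k
    unfolding fourier_coeff_def by (metis minus_minus)
  then show ?thesis
    using f by (intro fourier_null_imp_AE_zero) (simp add: fourier_null_def)
qed

subsection \<open>Chains of atoms converging to a node\<close>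

lemma ennreal_sq_le_imp:
  assumes "ennreal (x\<^sup>2) \<le> ennreal y" "0 \<le> x" "0 \<le> y" "y \<le> z\<^sup>2" "0 \<le> z"
  shows "x \<le> z"
proof -
  have "x\<^sup>2 \<le> y" using assms(1,3) by simp
  also note \<open>y \<le> z\<^sup>2\<close>
  finally show ?thesis using \<open>0 \<le> z\<close> by (rule power2_le_imp_le)
qed

text \<open>\<open>v j\<close> stands for the boundary value at \<open>a j\<close>. The factor
  \<open>2 ^ j\<close> pays for the small mass of the j-th atom; distances shrinking like
  \<open>8 ^ j\<close> outweigh it, and after taking square roots a decay of
  \<open>1 / 2 ^ j\<close> remains.\<close>

locale atom_chain =
  fixes f :: "complex \<Rightarrow> complex" and \<xi> :: complex and \<rho> T :: real and a v :: "nat \<Rightarrow> complex"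
  assumes f: "integrable arc_length f"
    and \<xi>: "\<xi> \<in> \<T>"
    and \<rho>: "0 < \<rho>" "\<rho> \<le> 1"
    and T: "0 \<le> T"
    and a: "\<And>j. a j \<in> \<T>"
    and near: "\<And>j. cmod (a j - \<xi>) \<le> \<rho>\<^sup>2 / 8 ^ j"
    and quot: "\<And>j. diff_quot_sq f (a j) (v j) \<le> ennreal (2 ^ j * T)"
begin

text \<open>The point on the radius to the node whose depth equals the distance bound for
  \<open>a j\<close>, so that \<open>poisson_ext_near\<close> applies to both \<open>a j\<close> and
  \<open>a (Suc j)\<close>.\<close>

definition z :: "nat \<Rightarrow> complex" where
  "z j = of_real (1 - \<rho>\<^sup>2 / 8 ^ j) * \<xi>"

lemma r_bounds: "0 < \<rho>\<^sup>2 / 8 ^ j" "\<rho>\<^sup>2 / 8 ^ j \<le> 1"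
proof -
  show "0 < \<rho>\<^sup>2 / 8 ^ j" using \<rho> by simp
  have "\<rho>\<^sup>2 \<le> 1" using \<rho> by (simp add: power_le_one)
  also have "(1::real) \<le> 8 ^ j" by simp
  finally show "\<rho>\<^sup>2 / 8 ^ j \<le> 1" by simp
qed

lemma cmod_z: "cmod (z j) = 1 - \<rho>\<^sup>2 / 8 ^ j"
  using r_bounds[of j] \<xi> unfolding z_def norm_mult norm_of_real by simp

lemma cmod_z_diff: "cmod (z j - \<xi>) = \<rho>\<^sup>2 / 8 ^ j"
proof -
  have "z j - \<xi> = of_real (- (\<rho>\<^sup>2 / 8 ^ j)) * \<xi>" by (simp add: z_def algebra_simps)
  then have "cmod (z j - \<xi>) = \<bar>- (\<rho>\<^sup>2 / 8 ^ j)\<bar> * cmod \<xi>"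
    by (simp only: norm_mult norm_of_real)
  also have "\<bar>- (\<rho>\<^sup>2 / 8 ^ j)\<bar> = \<rho>\<^sup>2 / 8 ^ j"
    using r_bounds(1)[of j] by linarith
  finally show ?thesis using \<xi> by simp
qed

text \<open>With \<open>2 ^ k \<le> 2 * 2 ^ j\<close> the squared error is at most
  \<open>36 * \<rho>\<^sup>2 * T / 4 ^ j\<close>.\<close>

lemma poisson_z:
  assumes "k = j \<or> k = Suc j"
  shows "cmod (poisson_ext f (z j) - v k) \<le> 6 * \<rho> * sqrt T / 2 ^ j"
proof -
  have "cmod (a k - \<xi>) \<le> \<rho>\<^sup>2 / 8 ^ j"
  proof -
    have "(8::real) ^ j \<le> 8 ^ k" using assms by (intro power_increasing) auto
    then have "\<rho>\<^sup>2 / 8 ^ k \<le> \<rho>\<^sup>2 / 8 ^ j" by (intro divide_left_mono) auto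
    with near[of k] show ?thesis by linarith
  qed
  then have "cmod (a k - z j) \<le> 2 * (1 - cmod (z j))"
    using norm_triangle_ineq4[of "a k - \<xi>" "z j - \<xi>"] by (simp add: cmod_z cmod_z_diff)
  then have "ennreal ((cmod (poisson_ext f (z j) - v k))\<^sup>2)
      \<le> ennreal (18 * (1 - cmod (z j))) * diff_quot_sq f (a k) (v k)"
    using r_bounds[of j] by (intro poisson_ext_near f) (simp_all add: cmod_z)
  also have "\<dots> \<le> ennreal (18 * (1 - cmod (z j))) * ennreal (2 ^ k * T)"
    by (intro mult_left_mono quot) simp
  also have "\<dots> = ennreal (18 * (\<rho>\<^sup>2 / 8 ^ j) * (2 ^ k * T))"
    using T by (simp add: cmod_z flip: ennreal_mult)
  finally show ?thesis
  proof (rule ennreal_sq_le_imp)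
    have "(2::real) ^ k \<le> 2 * 2 ^ j" using assms by auto
    then have "18 * (\<rho>\<^sup>2 / 8 ^ j) * (2 ^ k * T) \<le> 18 * (\<rho>\<^sup>2 / 8 ^ j) * ((2 * 2 ^ j) * T)"
      using T by (intro mult_left_mono mult_right_mono) auto
    also have "(8::real) ^ j = 2 ^ j * 2 ^ j * 2 ^ j" by (simp flip: power_mult_distrib)
    then have "18 * (\<rho>\<^sup>2 / 8 ^ j) * ((2 * 2 ^ j) * T) = (6 * \<rho> * sqrt T / 2 ^ j)\<^sup>2"
      using T by (simp add: power_divide power_mult_distrib) (simp add: power2_eq_square)
    finally show "18 * (\<rho>\<^sup>2 / 8 ^ j) * (2 ^ k * T) \<le> (6 * \<rho> * sqrt T / 2 ^ j)\<^sup>2" .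
  qed (use \<rho> T in auto)
qed

text \<open>Neighbouring values are compared through \<open>z j\<close>. The bound is the exact
  partial sum of the geometric series \<open>12 * \<rho> * sqrt T / 2 ^ i\<close>, which lets the
  induction close.\<close>

lemma v_dist: "cmod (v 0 - v j) \<le> 24 * \<rho> * sqrt T * (1 - 1 / 2 ^ j)"
proof (induction j)
  case 0
  show ?case by simp
next
  case (Suc j)
  have "cmod (v j - v (Suc j)) \<le> cmod (poisson_ext f (z j) - v j) + cmod (poisson_ext f (z j) - v (Suc j))"
    using norm_triangle_ineq4[of "poisson_ext f (z j) - v (Suc j)" "poisson_ext f (z j) - v j"] by simp
  also have "\<dots> \<le> 6 * \<rho> * sqrt T / 2 ^ j + 6 * \<rho> * sqrt T / 2 ^ j"
    by (intro add_mono poisson_z) auto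
  finally have "cmod (v j - v (Suc j)) \<le> 12 * \<rho> * sqrt T / 2 ^ j" by simp
  then have "cmod (v 0 - v (Suc j)) \<le> 24 * \<rho> * sqrt T * (1 - 1 / 2 ^ j) + 12 * \<rho> * sqrt T / 2 ^ j"
    using Suc norm_triangle_ineq[of "v 0 - v j" "v j - v (Suc j)"] by simp
  also have "\<dots> = 24 * \<rho> * sqrt T * (1 - 1 / 2 ^ Suc j)"
    by (simp add: field_simps)
  finally show ?case .
qed

lemma v_dist': "cmod (v 0 - v j) \<le> 24 * \<rho> * sqrt T"
proof -
  have "24 * \<rho> * sqrt T * (1 - 1 / 2 ^ j) \<le> 24 * \<rho> * sqrt T * 1"
    using \<rho> T by (intro mult_left_mono) auto
  with v_dist[of j] show ?thesis by linarith
qed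

lemma inverse_power_to_zero: "(\<lambda>j. c / b ^ j) \<longlonglongrightarrow> 0" if "b > 1" for b c :: real
  using that by real_asymp

text \<open>The points \<open>z j\<close> approach the node radially, hence inside the Stolz region
  of aperture 2, and the Poisson extension at \<open>z j\<close> differs from \<open>v j\<close> by
  a null sequence.\<close>

lemma v_tendsto:
  assumes "has_nt_limit f \<xi> l"
  shows "v \<longlonglongrightarrow> l"
proof -
  have lim: "(poisson_ext f \<longlongrightarrow> l) (at \<xi> within stolz_region 2 \<xi>)"
    using assms by (simp add: has_nt_limit_def)
  have "(\<lambda>j. cmod (z j - \<xi>)) \<longlonglongrightarrow> 0"
    unfolding cmod_z_diff by (rule inverse_power_to_zero) simp
  then have "z \<longlonglongrightarrow> \<xi>" by (metis LIM_zero_iff tendsto_norm_zero_iff)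
  moreover have "z j \<noteq> \<xi>" "z j \<in> stolz_region 2 \<xi>" for j
    using r_bounds[of j] cmod_z_diff[of j] by (auto simp: stolz_region_def cmod_z)
  ultimately have "filterlim z (at \<xi> within stolz_region 2 \<xi>) sequentially"
    by (simp add: filterlim_at)
  with lim have "(\<lambda>j. poisson_ext f (z j)) \<longlonglongrightarrow> l"
    by (rule filterlim_compose)
  moreover have "(\<lambda>j. poisson_ext f (z j) - v j) \<longlonglongrightarrow> 0"
  proof (rule Lim_null_comparison)
    show "\<forall>\<^sub>F j in sequentially. cmod (poisson_ext f (z j) - v j) \<le> 6 * \<rho> * sqrt T / 2 ^ j"
      using poisson_z by simp
    show "(\<lambda>j. 6 * \<rho> * sqrt T / 2 ^ j) \<longlonglongrightarrow> 0"
      by (rule inverse_power_to_zero) simp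
  qed
  ultimately have "(\<lambda>j. poisson_ext f (z j) - (poisson_ext f (z j) - v j)) \<longlonglongrightarrow> l - 0"
    by (rule tendsto_diff)
  then show ?thesis by simp
qed

lemma v0_le:
  assumes "has_nt_limit f \<xi> 0"
  shows "cmod (v 0) \<le> 24 * \<rho> * sqrt T"
proof (rule LIMSEQ_le_const2)
  show "(\<lambda>j. cmod (v 0 - v j)) \<longlonglongrightarrow> cmod (v 0)"
    using v_tendsto[OF assms] by (auto intro!: tendsto_eq_intros)
qed (use v_dist' in auto)

text \<open>On the disc \<open>cmod (\<zeta> - a 0) \<le> 2 * \<rho>\<close>, which bounds
  \<open>f - v 0\<close> by the difference quotient, and \<open>v0_le\<close> bounds
  \<open>v 0\<close>. The constant is \<open>1160 = 8 + 2 * 24\<^sup>2\<close>.\<close>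

lemma nn_integral_cball_le:
  assumes "has_nt_limit f \<xi> 0"
  shows "(\<integral>\<^sup>+\<zeta>. ennreal ((cmod (f \<zeta>))\<^sup>2) * indicator (cball \<xi> \<rho>) \<zeta> \<partial>arc_length) \<le> ennreal (1160 * \<rho>\<^sup>2 * T)"
proof -
  have [measurable]: "f \<in> borel_measurable circle_borel"
    using borel_measurable_integrable[OF f] by simp
  let ?q = "\<lambda>\<zeta>. (cmod ((f \<zeta> - v 0) / (\<zeta> - a 0)))\<^sup>2"
  have "AE \<zeta> in arc_length. ennreal ((cmod (f \<zeta>))\<^sup>2) * indicator (cball \<xi> \<rho>) \<zeta>
      \<le> ennreal (8 * \<rho>\<^sup>2) * ennreal (?q \<zeta>) + ennreal (1152 * \<rho>\<^sup>2 * T)"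
    using AE_arc_length_neq[of "a 0"]
  proof eventually_elim
    case (elim \<zeta>)
    show ?case
    proof (cases "\<zeta> \<in> cball \<xi> \<rho>")
      case True
      have "\<rho> * \<rho> \<le> \<rho> * 1" using \<rho> by (intro mult_left_mono) auto
      moreover have "cmod (a 0 - \<xi>) \<le> \<rho> * \<rho>"
        using near[of 0] by (simp add: power2_eq_square)
      ultimately have "cmod (a 0 - \<xi>) \<le> \<rho>" by linarith
      then have "cmod (\<zeta> - a 0) \<le> 2 * \<rho>"
        using True norm_triangle_ineq4[of "\<zeta> - \<xi>" "a 0 - \<xi>"] by (simp add: dist_norm norm_minus_commute)
      then have "(cmod (\<zeta> - a 0))\<^sup>2 \<le> (2 * \<rho>)\<^sup>2" by (intro power_mono) auto
      then have "(cmod (\<zeta> - a 0))\<^sup>2 * ?q \<zeta> \<le> (2 * \<rho>)\<^sup>2 * ?q \<zeta>"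
        by (intro mult_right_mono) auto
      moreover have "(cmod (\<zeta> - a 0))\<^sup>2 * ?q \<zeta> = (cmod (f \<zeta> - v 0))\<^sup>2"
        using elim by (simp add: norm_divide power_divide)
      ultimately have 1: "(cmod (f \<zeta> - v 0))\<^sup>2 \<le> 4 * \<rho>\<^sup>2 * ?q \<zeta>"
        by (simp add: power_mult_distrib)
      have "(cmod (v 0))\<^sup>2 \<le> (24 * \<rho> * sqrt T)\<^sup>2"
        using v0_le[OF assms] by (intro power_mono) auto
      then have 2: "(cmod (v 0))\<^sup>2 \<le> 576 * \<rho>\<^sup>2 * T"
        using T by (simp add: power_mult_distrib)
      have "cmod (f \<zeta>) \<le> cmod (f \<zeta> - v 0) + cmod (v 0)"
        using norm_triangle_ineq[of "f \<zeta> - v 0" "v 0"] by simp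
      then have "(cmod (f \<zeta>))\<^sup>2 \<le> (cmod (f \<zeta> - v 0) + cmod (v 0))\<^sup>2"
        by (intro power_mono) auto
      also have "\<dots> \<le> 2 * (cmod (f \<zeta> - v 0))\<^sup>2 + 2 * (cmod (v 0))\<^sup>2"
        using zero_le_power2[of "cmod (f \<zeta> - v 0) - cmod (v 0)"]
        by (simp add: power2_sum power2_diff)
      also have "\<dots> \<le> 8 * \<rho>\<^sup>2 * ?q \<zeta> + 1152 * \<rho>\<^sup>2 * T" using 1 2 by linarith
      finally have "ennreal ((cmod (f \<zeta>))\<^sup>2) \<le> ennreal (8 * \<rho>\<^sup>2 * ?q \<zeta> + 1152 * \<rho>\<^sup>2 * T)"
        by (rule ennreal_leI)
      then show ?thesis using True T by (simp add: ennreal_plus ennreal_mult)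
    qed simp
  qed
  then have "(\<integral>\<^sup>+\<zeta>. ennreal ((cmod (f \<zeta>))\<^sup>2) * indicator (cball \<xi> \<rho>) \<zeta> \<partial>arc_length)
      \<le> (\<integral>\<^sup>+\<zeta>. ennreal (8 * \<rho>\<^sup>2) * ennreal (?q \<zeta>) + ennreal (1152 * \<rho>\<^sup>2 * T) \<partial>arc_length)"
    by (rule nn_integral_mono_AE)
  also have "\<dots> = ennreal (8 * \<rho>\<^sup>2) * diff_quot_sq f (a 0) (v 0) + ennreal (1152 * \<rho>\<^sup>2 * T)"
    by (simp add: nn_integral_add nn_integral_cmult diff_quot_sq_def arc.emeasure_space_1)
  also have "\<dots> \<le> ennreal (8 * \<rho>\<^sup>2) * ennreal T + ennreal (1152 * \<rho>\<^sup>2 * T)"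
    using quot[of 0] by (intro add_right_mono mult_left_mono) auto
  also have "\<dots> = ennreal (1160 * \<rho>\<^sup>2 * T)"
    using T by (simp flip: ennreal_mult ennreal_plus)
  finally show ?thesis .
qed

end

section \<open>Lower bounds for test functions of the capacity\<close>

lemma one_le_cmod_of_diff_quot:
  assumes a: "a \<in> \<T>" and U: "open U" "a \<in> U" and ge: "AE \<zeta> in arc_length. \<zeta> \<in> U \<longrightarrow> 1 \<le> cmod (f \<zeta>)"
    and fin: "diff_quot_sq f a v < \<infinity>"
  shows "1 \<le> cmod v"
proof (rule ccontr)
  assume "\<not> ?thesis"
  define \<delta> where "\<delta> = 1 - cmod v"
  have "\<delta> > 0" using \<open>\<not> 1 \<le> cmod v\<close> by (simp add: \<delta>_def)
  obtain K where K: "diff_quot_sq f a v = ennreal K" "K \<ge> 0" using fin by (cases "diff_quot_sq f a v") auto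
  obtain e where e: "e > 0" "cball a e \<subseteq> U" using U open_contains_cball by blast
  \<comment> \<open>If \<open>cmod v < 1\<close>, the arc of radius \<open>s\<close> alone
    contributes at least \<open>\<delta>\<^sup>2 / (2 * pi * s)\<close> to the integral; the last
    bound on \<open>s\<close> pushes this above \<open>K\<close>.\<close>
  define s where "s = min (min e pi) (\<delta>\<^sup>2 / (2 * pi * (K + 1)))"
  have s: "0 < s" "s \<le> e" "s \<le> pi" "s \<le> \<delta>\<^sup>2 / (2 * pi * (K + 1))"
    using e K \<open>\<delta> > 0\<close> by (auto simp: s_def)
  have m: "cball a s \<inter> \<T> \<in> sets arc_length"
    by (simp add: sets_arc_length Int_circle_in_sets)
  have "ennreal (\<delta>\<^sup>2 / s\<^sup>2) * ennreal (s / (2*pi)) \<le> ennreal (\<delta>\<^sup>2 / s\<^sup>2) * emeasure arc_length (cball a s \<inter> \<T>)"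
    by (intro mult_left_mono emeasure_cball_arc_length a s) simp
  also have "\<dots> = (\<integral>\<^sup>+\<zeta>. ennreal (\<delta>\<^sup>2 / s\<^sup>2) * indicator (cball a s \<inter> \<T>) \<zeta> \<partial>arc_length)"
    using m by (simp add: nn_integral_cmult_indicator)
  also have "\<dots> \<le> diff_quot_sq f a v"
    unfolding diff_quot_sq_def
  proof (rule nn_integral_mono_AE)
    show "AE \<zeta> in arc_length. ennreal (\<delta>\<^sup>2 / s\<^sup>2) * indicator (cball a s \<inter> \<T>) \<zeta>
        \<le> ennreal ((cmod ((f \<zeta> - v) / (\<zeta> - a)))\<^sup>2)"
      using ge AE_arc_length_neq[of a]
    proof eventually_elim
      case (elim \<zeta>)
      show ?case
      proof (cases "\<zeta> \<in> cball a s")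
        case True
        then have "\<zeta> \<in> cball a e" using s by auto
        then have "1 \<le> cmod (f \<zeta>)" using elim(1) e(2) by blast
        then have "\<delta> \<le> cmod (f \<zeta> - v)"
          using norm_triangle_ineq2[of "f \<zeta>" v] by (simp add: \<delta>_def)
        moreover have "cmod (\<zeta> - a) \<le> s" "cmod (\<zeta> - a) > 0"
          using True elim(2) by (auto simp: dist_norm norm_minus_commute)
        ultimately have "\<delta> / s \<le> cmod ((f \<zeta> - v) / (\<zeta> - a))"
          unfolding norm_divide using \<open>\<delta> > 0\<close> by (intro frac_le) auto
        then have "(\<delta> / s)\<^sup>2 \<le> (cmod ((f \<zeta> - v) / (\<zeta> - a)))\<^sup>2"
          using \<open>\<delta> > 0\<close> s by (intro power_mono) auto
        then have "ennreal (\<delta>\<^sup>2 / s\<^sup>2) \<le> ennreal ((cmod ((f \<zeta> - v) / (\<zeta> - a)))\<^sup>2)"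
          unfolding power_divide by (rule ennreal_leI)
        then show ?thesis by (simp add: indicator_def)
      qed simp
    qed
  qed
  finally have "\<delta>\<^sup>2 / s\<^sup>2 * (s / (2*pi)) \<le> K"
    using K s by (simp flip: ennreal_mult)
  then have "\<delta>\<^sup>2 \<le> 2 * pi * s * K"
    using s by (simp add: field_simps power2_eq_square)
  moreover have "2 * pi * s * (K + 1) \<le> \<delta>\<^sup>2"
  proof -
    have "0 < 2 * pi * (K + 1)" using K by simp
    then have "s * (2 * pi * (K + 1)) \<le> \<delta>\<^sup>2"
      using s(4) by (simp only: pos_le_divide_eq)
    then show ?thesis by (simp only: ac_simps)
  qed
  moreover have "2 * pi * s * K < 2 * pi * s * (K + 1)" using s by simp
  ultimately show False by linarith
qed

lemma poisson_ext_0_le: 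
  assumes "f \<in> L2_circle"
  shows "ennreal ((cmod (poisson_ext f 0))\<^sup>2) \<le> L2_norm_sq f"
proof -
  have [measurable]: "f \<in> borel_measurable circle_borel"
    using borel_measurable_integrable[OF L2_circle_integrable[OF assms]] by simp
  have "poisson_ext f 0 = (LINT \<zeta>|arc_length. f \<zeta>)"
    unfolding poisson_ext_def by (rule Bochner_Integration.integral_cong) (simp_all add: space_arc_length)
  then have "ennreal (cmod (poisson_ext f 0)) \<le> (\<integral>\<^sup>+\<zeta>. ennreal (cmod (f \<zeta>)) * 1 \<partial>arc_length)"
    using integral_norm_bound_ennreal[OF L2_circle_integrable[OF assms]] by simp
  then have "(ennreal (cmod (poisson_ext f 0)))\<^sup>2 \<le> (\<integral>\<^sup>+\<zeta>. ennreal (cmod (f \<zeta>)) * 1 \<partial>arc_length)\<^sup>2"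
    by (rule power_mono) simp
  also have "\<dots> \<le> (\<integral>\<^sup>+\<zeta>. (ennreal (cmod (f \<zeta>)))\<^sup>2 \<partial>arc_length) * (\<integral>\<^sup>+\<zeta>. 1\<^sup>2 \<partial>arc_length)"
    by (rule Cauchy_Schwarz_nn_integral) auto
  also have "\<dots> = L2_norm_sq f"
    by (simp add: L2_norm_sq_def ennreal_power arc.emeasure_space_1)
  finally show ?thesis by (simp add: ennreal_power)
qed

text \<open>Some atom \<open>a j\<close> lies in \<open>U\<close>, so
  \<open>cmod (v j) \<ge> 1\<close>. The path from \<open>v j\<close> over \<open>v 0\<close> to the
  mean of \<open>f\<close> costs \<open>24 + 5\<close> times \<open>sqrt T\<close>, and the L2 norm
  bounds the mean.\<close>

lemma (in atom_chain) capacity_test: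
  assumes L2: "f \<in> L2_circle" and M: "L2_norm_sq f \<le> ennreal (M\<^sup>2)" "0 \<le> M"
    and U: "open U" "\<xi> \<in> U" and ge: "AE \<zeta> in arc_length. \<zeta> \<in> U \<longrightarrow> 1 \<le> cmod (f \<zeta>)"
  shows "1 \<le> M + 29 * sqrt T"
proof -
  have "(\<lambda>j. a j - \<xi>) \<longlonglongrightarrow> 0"
  proof (rule Lim_null_comparison)
    show "\<forall>\<^sub>F j in sequentially. cmod (a j - \<xi>) \<le> \<rho>\<^sup>2 / 8 ^ j" using near by simp
  qed (rule inverse_power_to_zero, simp)
  then have "a \<longlonglongrightarrow> \<xi>" by (rule LIM_zero_cancel)
  then have "\<forall>\<^sub>F j in sequentially. a j \<in> U" using U by (rule topological_tendstoD)
  then obtain j where "a j \<in> U" by (auto simp: eventually_sequentially)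
  moreover have "diff_quot_sq f (a j) (v j) < \<infinity>"
    using quot[of j] by (simp add: le_less_trans)
  ultimately have "1 \<le> cmod (v j)"
    using one_le_cmod_of_diff_quot[OF a U(1) _ ge] by blast
  also have "cmod (v j) \<le> cmod (v 0) + cmod (v 0 - v j)"
    using norm_triangle_ineq4[of "v 0" "v 0 - v j"] by simp
  also have "cmod (v 0) \<le> cmod (poisson_ext f 0) + cmod (poisson_ext f 0 - v 0)"
    using norm_triangle_ineq4[of "poisson_ext f 0" "poisson_ext f 0 - v 0"] by simp
  also have "cmod (poisson_ext f 0) \<le> M"
    using order_trans[OF poisson_ext_0_le[OF L2] M(1)] by (rule ennreal_sq_le_imp) (use M in auto)
  also have "cmod (poisson_ext f 0 - v 0) \<le> 5 * sqrt T"
  proof (rule ennreal_sq_le_imp)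
    have "ennreal ((cmod (poisson_ext f 0 - v 0))\<^sup>2) \<le> ennreal (18 * (1 - cmod 0)) * diff_quot_sq f (a 0) (v 0)"
      using a[of 0] by (intro poisson_ext_near f) auto
    also have "\<dots> \<le> ennreal (18 * (1 - cmod 0)) * ennreal (2 ^ 0 * T)"
      by (intro mult_left_mono quot) simp
    also have "\<dots> = ennreal (18 * T)"
      using T by (simp add: ennreal_mult)
    finally show "ennreal ((cmod (poisson_ext f 0 - v 0))\<^sup>2) \<le> ennreal (18 * T)" .
  qed (use T in \<open>auto simp: power_mult_distrib\<close>)
  also have "cmod (v 0 - v j) \<le> 24 * sqrt T"
  proof -
    have "\<rho> * sqrt T \<le> 1 * sqrt T" using \<rho> T by (intro mult_right_mono) auto
    with v_dist'[of j] show ?thesis by linarith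
  qed
  finally show ?thesis by simp
qed

subsection \<open>The measure carried by the atoms\<close>

text \<open>Since \<open>g\<close> may fail to be measurable, it is cut down to the countable range
  of \<open>a\<close>, where every function is measurable. It will be applied to the local Dirichlet
  integral as a function of the point.\<close>

lemma nn_integral_distr_pmf_ge:
  fixes p :: "'x :: countable pmf" and g :: "complex \<Rightarrow> ennreal"
  assumes a: "\<And>x. a x \<in> \<T>"
  shows "(\<integral>\<^sup>+x. g (a x) \<partial>measure_pmf p) \<le> (\<integral>\<^sup>+\<xi>. g \<xi> \<partial>distr (measure_pmf p) circle_borel a)"
proof -
  define h where "h \<xi> = (if \<xi> \<in> range a then g \<xi> else 0)" for \<xi>
  have meas: "h \<in> borel_measurable circle_borel"
  proof (rule measurable_discrete_difference[where f = "\<lambda>_. 0" and X = "range a"])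
    show "{x} \<in> sets circle_borel" if "x \<in> range a" for x
      using that a Int_circle_in_sets[of "{x}"] by auto
  qed (auto simp: h_def)
  have "(\<integral>\<^sup>+x. g (a x) \<partial>measure_pmf p) = (\<integral>\<^sup>+\<xi>. h \<xi> \<partial>distr (measure_pmf p) circle_borel a)"
    using a meas by (subst nn_integral_distr) (auto simp: space_circle_borel h_def)
  also have "\<dots> \<le> (\<integral>\<^sup>+\<xi>. g \<xi> \<partial>distr (measure_pmf p) circle_borel a)"
    by (rule nn_integral_mono) (simp add: h_def)
  finally show ?thesis .
qed

lemma discrete_measure_distr_pmf:
  fixes p :: "(nat \<times> nat) pmf"
  assumes a: "\<And>x. a x \<in> \<T>"
  shows "discrete_measure (distr (measure_pmf p) circle_borel a)"
  unfolding discrete_measure_def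
proof (intro exI conjI ballI)
  show "range (\<lambda>n. a (prod_decode n)) \<subseteq> space (distr (measure_pmf p) circle_borel a)"
    using a by (simp only: space_distr space_circle_borel) blast
  fix A assume "A \<in> sets (distr (measure_pmf p) circle_borel a)"
  then have A: "A \<in> sets circle_borel" by simp
  have "emeasure (distr (measure_pmf p) circle_borel a) A = emeasure (measure_pmf p) (a -` A)"
    using A a by (subst emeasure_distr) (auto simp: space_circle_borel)
  also have "\<dots> = (\<integral>\<^sup>+x. indicator (a -` A) x \<partial>measure_pmf p)"
    by simp
  also have "\<dots> = (\<integral>\<^sup>+x. ennreal (pmf p x) * indicator A (a x) \<partial>count_space UNIV)"
    by (simp add: nn_integral_measure_pmf indicator_def)
  also have "\<dots> = (\<integral>\<^sup>+n. ennreal (pmf p (prod_decode n)) * indicator A (a (prod_decode n)) \<partial>count_space UNIV)"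
    by (rule nn_integral_bij_count_space[symmetric]) (rule bij_prod_decode)
  also have "\<dots> = (\<Sum>n. ennreal (pmf p (prod_decode n)) * indicator A (a (prod_decode n)))"
    by (rule nn_integral_count_space_nat)
  finally show "emeasure (distr (measure_pmf p) circle_borel a) A
      = (\<Sum>n. ennreal (pmf p (prod_decode n)) * indicator A (a (prod_decode n)))" .
qed

lemma pmf_point_le_nn_integral: "ennreal (pmf p x) * g x \<le> (\<integral>\<^sup>+y. g y \<partial>measure_pmf p)"
proof -
  have "ennreal (pmf p x) * g x = (\<integral>\<^sup>+y. g x * indicator {x} y \<partial>measure_pmf p)"
    by (subst nn_integral_cmult_indicator) (auto simp: emeasure_pmf_single mult.commute)
  also have "\<dots> \<le> (\<integral>\<^sup>+y. g y \<partial>measure_pmf p)"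
    by (rule nn_integral_mono) (auto split: split_indicator)
  finally show ?thesis .
qed

text \<open>Without a non-tangential limit the right-hand side is infinite, so no case distinction
  survives.\<close>

lemma diff_quot_sq_le_local_dirichlet: "diff_quot_sq f a (nt_limit f a) \<le> local_dirichlet a f"
  by (auto simp: diff_quot_sq_def local_dirichlet_def)

text \<open>Every nontrivial arc is uncountable.\<close>

lemma circle_point_near_avoiding:
  assumes "\<xi> \<in> \<T>" "countable E" "0 < \<delta>"
  obtains a where "a \<in> \<T>" "a \<notin> E" "cmod (a - \<xi>) \<le> \<delta>"
proof -
  obtain t where t: "\<xi> = cis t" using circle_cis[OF assms(1)] by metis
  define r where "r = min \<delta> 1"
  have r: "0 < r" "r \<le> \<delta>" "r \<le> 1" using assms(3) by (auto simp: r_def)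
  have "inj_on cis {t<..<t + r}"
  proof (rule inj_onI)
    fix x y assume xy: "x \<in> {t<..<t + r}" "y \<in> {t<..<t + r}" "cis x = cis y"
    then have "\<bar>(x - y) / 2\<bar> < pi" using r pi_gt3 by auto
    moreover have "sin ((x - y) / 2) = 0" using cmod_cis_diff[of x y] xy(3) by simp
    ultimately have "(x - y) / 2 = 0" using sin_eq_0_pi[of "(x - y) / 2"] by auto
    then show "x = y" by simp
  qed
  moreover have "uncountable {t<..<t + r}" using r by (simp add: uncountable_open_interval)
  ultimately have "uncountable (cis ` {t<..<t + r})"
    using countable_image_inj_on by blast
  then have "\<not> cis ` {t<..<t + r} \<subseteq> E" using assms(2) countable_subset by blast
  then obtain x where x: "x \<in> {t<..<t + r}" "cis x \<notin> E" by blast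
  show thesis
  proof (rule that[of "cis x"])
    have "\<bar>x - t\<bar> \<le> \<delta>" using x r by auto
    then show "cmod (cis x - \<xi>) \<le> \<delta>" unfolding t using dist_cis_le[of x t] by linarith
  qed (use x in auto)
qed

text \<open>\<open>summable\<close> allows the atoms near \<open>\<xi> i\<close> to carry mass
  proportional to \<open>\<rho> i\<close>, \<open>cover\<close> makes the discs reach almost every
  point, and \<open>weight\<close> bounds the exponential weight on the i-th disc by
  \<open>1 / \<rho> i\<close>.\<close>

locale arc_cover =
  fixes \<xi> :: "nat \<Rightarrow> complex" and \<rho> :: "nat \<Rightarrow> real"
  assumes \<xi>: "\<And>i. \<xi> i \<in> \<T>"
    and \<rho>: "\<And>i. 0 < \<rho> i" "\<And>i. \<rho> i \<le> 1"
    and summable: "summable \<rho>"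
    and cover: "\<And>\<zeta>. \<zeta> \<in> \<T> \<Longrightarrow> \<zeta> \<noteq> 1 \<Longrightarrow> \<exists>i. \<zeta> \<in> cball (\<xi> i) (\<rho> i)"
    and weight: "\<And>\<zeta> i. \<zeta> \<in> \<T> \<Longrightarrow> \<zeta> \<in> cball (\<xi> i) (\<rho> i) \<Longrightarrow> exp (16 / (cmod (1 - \<zeta>))\<^sup>2) \<le> 1 / \<rho> i"
begin

definition E :: "complex set" where "E = insert 1 (range \<xi>)"

text \<open>Atoms avoid \<open>E\<close>, which makes \<open>E\<close> a null set for
  \<open>\<mu>\<close>; their distance to the node is the one required by
  \<open>atom_chain\<close>.\<close>

definition atom :: "nat \<times> nat \<Rightarrow> complex" where
  "atom = (\<lambda>(i, j). SOME x. x \<in> \<T> \<and> x \<notin> E \<and> cmod (x - \<xi> i) \<le> (\<rho> i)\<^sup>2 / 8 ^ j)"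

lemma countable_E: "countable E"
  by (simp add: E_def)

lemma atom: "atom (i, j) \<in> \<T>" "atom (i, j) \<notin> E" "cmod (atom (i, j) - \<xi> i) \<le> (\<rho> i)\<^sup>2 / 8 ^ j"
proof -
  have "\<exists>x. x \<in> \<T> \<and> x \<notin> E \<and> cmod (x - \<xi> i) \<le> (\<rho> i)\<^sup>2 / 8 ^ j"
    using circle_point_near_avoiding[OF \<xi>[of i] countable_E, of "(\<rho> i)\<^sup>2 / 8 ^ j"] \<rho>(1)[of i]
    by (metis zero_less_divide_iff zero_less_numeral zero_less_power)
  from someI_ex[OF this] show "atom (i, j) \<in> \<T>" "atom (i, j) \<notin> E" "cmod (atom (i, j) - \<xi> i) \<le> (\<rho> i)\<^sup>2 / 8 ^ j"
    by (simp_all add: atom_def)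
qed

lemma atom_circle: "atom x \<in> \<T>"
  by (cases x) (simp only: atom)

definition S :: real where "S = suminf \<rho>"

lemma S_pos: "S > 0"
  unfolding S_def using summable \<rho>(1) by (intro suminf_pos)

definition row :: "nat pmf" where "row = embed_pmf (\<lambda>i. \<rho> i / S)"

lemma pmf_row: "pmf row i = \<rho> i / S"
  unfolding row_def
proof (rule pmf_embed_pmf)
  show "0 \<le> \<rho> i / S" for i using \<rho>(1)[of i] S_pos by simp
  have "(\<lambda>i. \<rho> i / S) sums (S / S)"
    unfolding S_def by (intro sums_divide summable_sums summable)
  then have "(\<Sum>i. ennreal (\<rho> i / S)) = ennreal 1"
    using \<rho>(1) S_pos by (subst suminf_ennreal2) (auto simp: sums_iff less_imp_le)
  then show "(\<integral>\<^sup>+i. ennreal (\<rho> i / S) \<partial>count_space UNIV) = 1"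
    by (simp add: nn_integral_count_space_nat)
qed

definition col :: "nat pmf" where "col = geometric_pmf (1 / 2)"

lemma pmf_col: "pmf col j = 1 / 2 ^ Suc j"
  by (simp add: col_def power_one_over)

text \<open>Atom \<open>(i, j)\<close> contributes mass \<open>\<rho> i / S / 2 ^ Suc j\<close>. The
  product form turns the energy into an iterated integral over nodes and their chains.\<close>

definition \<mu> :: "complex measure" where
  "\<mu> = distr (measure_pmf (pair_pmf row col)) circle_borel atom"

definition row_energy :: "(complex \<Rightarrow> complex) \<Rightarrow> nat \<Rightarrow> ennreal" where
  "row_energy f i = (\<integral>\<^sup>+j. local_dirichlet (atom (i, j)) f \<partial>measure_pmf col)"

lemma nn_integral_row_energy: "(\<integral>\<^sup>+i. row_energy f i \<partial>measure_pmf row) \<le> dirichlet_integral \<mu> f"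
proof -
  have "(\<integral>\<^sup>+i. row_energy f i \<partial>measure_pmf row)
      = (\<integral>\<^sup>+x. local_dirichlet (atom x) f \<partial>measure_pmf (pair_pmf row col))"
    by (simp add: nn_integral_pair_pmf' row_energy_def)
  also have "\<dots> \<le> dirichlet_integral \<mu> f"
    unfolding \<mu>_def dirichlet_integral_def by (rule nn_integral_distr_pmf_ge) (rule atom_circle)
  finally show ?thesis .
qed

lemma row_energy_le: "ennreal (\<rho> i / S) * row_energy f i \<le> dirichlet_integral \<mu> f"
  using order_trans[OF pmf_point_le_nn_integral nn_integral_row_energy] by (simp add: pmf_row)

text \<open>The parameter is \<open>2 * t\<close> because the j-th atom of a row has relative mass
  \<open>1 / 2 ^ Suc j\<close>, not \<open>1 / 2 ^ j\<close>.\<close>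

lemma atom_chain:
  assumes f: "integrable arc_length f" and t: "row_energy f i \<le> ennreal t" "0 \<le> t"
  shows "atom_chain f (\<xi> i) (\<rho> i) (2 * t) (\<lambda>j. atom (i, j)) (\<lambda>j. nt_limit f (atom (i, j)))"
proof
  fix j
  let ?D = "diff_quot_sq f (atom (i, j)) (nt_limit f (atom (i, j)))"
  have "ennreal (1 / 2 ^ Suc j) * ?D \<le> ennreal (pmf col j) * local_dirichlet (atom (i, j)) f"
    unfolding pmf_col by (intro mult_left_mono diff_quot_sq_le_local_dirichlet) simp
  also have "\<dots> \<le> row_energy f i"
    unfolding row_energy_def by (rule pmf_point_le_nn_integral)
  finally have "ennreal (2 ^ Suc j) * (ennreal (1 / 2 ^ Suc j) * ?D) \<le> ennreal (2 ^ Suc j) * ennreal t"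
    using t(1) by (intro mult_left_mono) auto
  moreover have "ennreal (2 ^ Suc j) * ennreal (1 / 2 ^ Suc j) = 1"
    by (subst ennreal_mult[symmetric]) auto
  ultimately have "?D \<le> ennreal (2 ^ Suc j) * ennreal t"
    by (simp only: mult.assoc[symmetric] mult_1)
  also have "\<dots> = ennreal (2 ^ j * (2 * t))"
    using t(2) by (subst ennreal_mult[symmetric]) (auto simp: ac_simps)
  finally show "?D \<le> ennreal (2 ^ j * (2 * t))" .
qed (use f \<xi> \<rho> t atom in auto)

text \<open>A test function of tiny norm for a set containing the node would have small mean and
  small row energy, contrary to \<open>capacity_test\<close>. Thus no node can hide in an
  exceptional set.\<close>

lemma capacity_zero_notin:
  assumes "capacity \<mu> N = 0"
  shows "\<xi> i \<notin> N"
proof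
  assume "\<xi> i \<in> N"
  define c where "c = \<rho> i / S"
  have "c > 0" using \<rho>(1)[of i] S_pos by (simp add: c_def)
  \<comment> \<open>\<open>26912 = 2 * 116\<^sup>2\<close> and \<open>116 = 4 * 29\<close>: both
    summands in \<open>capacity_test\<close> become at most \<open>1 / 4\<close>.\<close>
  define \<epsilon> where "\<epsilon> = min (1 / 16) (c / 26912)"
  have \<epsilon>: "0 < \<epsilon>" "\<epsilon> \<le> (1 / 4)\<^sup>2" "\<epsilon> \<le> c / 26912"
    using \<open>c > 0\<close> by (auto simp: \<epsilon>_def power2_eq_square)
  have "capacity \<mu> N < ennreal \<epsilon>" using assms \<epsilon> by simp
  then obtain f U where f: "f \<in> harmonic_dirichlet_space \<mu>" "dirichlet_norm_sq \<mu> f < ennreal \<epsilon>"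
    and U: "open U" "N \<subseteq> U" "AE \<zeta> in arc_length. \<zeta> \<in> U \<longrightarrow> 1 \<le> cmod (f \<zeta>)"
    unfolding capacity_def INF_less_iff by auto
  have L2: "f \<in> L2_circle" using f by (simp add: harmonic_dirichlet_space_def)
  have "L2_norm_sq f \<le> dirichlet_norm_sq \<mu> f" "dirichlet_integral \<mu> f \<le> dirichlet_norm_sq \<mu> f"
    by (auto simp: dirichlet_norm_sq_def)
  then have norm: "L2_norm_sq f \<le> ennreal \<epsilon>" and D: "dirichlet_integral \<mu> f \<le> ennreal \<epsilon>"
    using f(2) by auto
  have "ennreal (1 / c) * (ennreal c * row_energy f i) \<le> ennreal (1 / c) * ennreal \<epsilon>"
    using row_energy_le[of i f] D by (intro mult_left_mono) (auto simp: c_def)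
  moreover have "ennreal (1 / c) * ennreal c = 1"
    using \<open>c > 0\<close> by (subst ennreal_mult[symmetric]) auto
  ultimately have "row_energy f i \<le> ennreal (1 / c) * ennreal \<epsilon>"
    by (simp only: mult.assoc[symmetric] mult_1)
  also have "\<dots> = ennreal (\<epsilon> / c)"
    using \<open>c > 0\<close> \<epsilon> by (subst ennreal_mult[symmetric]) auto
  finally interpret chain: atom_chain f "\<xi> i" "\<rho> i" "2 * (\<epsilon> / c)" "\<lambda>j. atom (i, j)" "\<lambda>j. nt_limit f (atom (i, j))"
    using L2_circle_integrable[OF L2] \<epsilon> \<open>c > 0\<close> by (intro atom_chain) auto
  have "L2_norm_sq f \<le> ennreal ((1 / 4)\<^sup>2)"
    using norm \<epsilon>(2) by (rule order_trans[OF _ ennreal_leI])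
  then have "1 \<le> 1 / 4 + 29 * sqrt (2 * (\<epsilon> / c))"
    using U \<open>\<xi> i \<in> N\<close> by (intro chain.capacity_test[OF L2]) auto
  moreover have "2 * (\<epsilon> / c) \<le> (1 / 116)\<^sup>2"
    using \<epsilon>(3) \<open>c > 0\<close> by (simp add: field_simps power2_eq_square)
  then have "sqrt (2 * (\<epsilon> / c)) \<le> 1 / 116"
    by (intro real_le_lsqrt) auto
  ultimately show False by simp
qed

lemma uniqueness: "uniqueness_set \<mu> E"
  unfolding uniqueness_set_def
proof (intro ballI impI)
  fix f assume f: "f \<in> dirichlet_space \<mu>" and qe: "quasi_everywhere_on \<mu> E (\<lambda>\<zeta>. has_nt_limit f \<zeta> 0)"
  have L2: "f \<in> L2_circle" and D: "dirichlet_integral \<mu> f < \<infinity>" and neg: "\<And>n. n < 0 \<Longrightarrow> fourier_coeff f n = 0"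
    using f by (auto simp: dirichlet_space_def harmonic_dirichlet_space_def)
  have int: "integrable arc_length f" by (rule L2_circle_integrable[OF L2])
  have [measurable]: "f \<in> borel_measurable circle_borel"
    using borel_measurable_integrable[OF int] by simp
  \<comment> \<open>Nodes lie outside every set of capacity zero, so the quasi-everywhere hypothesis
    holds at each of them.\<close>
  have nt: "has_nt_limit f (\<xi> i) 0" for i
    using qe capacity_zero_notin[of _ i] by (auto simp: quasi_everywhere_on_def E_def)
  have fin: "row_energy f i < \<infinity>" for i
  proof (rule ccontr)
    assume "\<not> ?thesis"
    then have "row_energy f i = \<infinity>" by (simp add: less_top[symmetric])
    moreover have "ennreal (\<rho> i / S) * row_energy f i < \<infinity>"
      using row_energy_le D by (rule le_less_trans)
    ultimately show False using \<rho>(1)[of i] S_pos by (simp add: ennreal_mult_top)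
  qed
  define t where "t i = enn2real (row_energy f i)" for i
  have t: "row_energy f i = ennreal (t i)" "0 \<le> t i" for i
    using fin[of i] by (auto simp: t_def)
  let ?B = "\<lambda>i \<zeta>. ennreal ((cmod (f \<zeta>))\<^sup>2) * indicator (cball (\<xi> i) (\<rho> i)) \<zeta>"
  have [measurable]: "(indicator (cball (\<xi> i) (\<rho> i)) :: complex \<Rightarrow> ennreal) \<in> borel_measurable circle_borel" for i
    by (intro borel_imp_circle_borel borel_measurable_indicator) simp
  have B: "(\<integral>\<^sup>+\<zeta>. ?B i \<zeta> \<partial>arc_length) \<le> ennreal (1160 * (\<rho> i)\<^sup>2 * (2 * t i))" for i
  proof -
    interpret chain: atom_chain f "\<xi> i" "\<rho> i" "2 * t i" "\<lambda>j. atom (i, j)" "\<lambda>j. nt_limit f (atom (i, j))"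
      using int t by (intro atom_chain) auto
    show ?thesis by (rule chain.nn_integral_cball_le[OF nt])
  qed
  have "(\<integral>\<^sup>+\<zeta>. ennreal ((cmod (f \<zeta>))\<^sup>2 * exp (16 / (cmod (1 - \<zeta>))\<^sup>2)) \<partial>arc_length)
      \<le> (\<integral>\<^sup>+\<zeta>. (\<Sum>i. ennreal (1 / \<rho> i) * ?B i \<zeta>) \<partial>arc_length)"
  proof (rule nn_integral_mono_AE)
    show "AE \<zeta> in arc_length. ennreal ((cmod (f \<zeta>))\<^sup>2 * exp (16 / (cmod (1 - \<zeta>))\<^sup>2))
        \<le> (\<Sum>i. ennreal (1 / \<rho> i) * ?B i \<zeta>)"
      using AE_arc_length_neq[of 1] AE_space
    proof eventually_elim
      case (elim \<zeta>)
      then have "\<zeta> \<in> \<T>" by (simp add: space_arc_length)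
      then obtain i where i: "\<zeta> \<in> cball (\<xi> i) (\<rho> i)" using cover elim(1) by blast
      have "(cmod (f \<zeta>))\<^sup>2 * exp (16 / (cmod (1 - \<zeta>))\<^sup>2) \<le> (cmod (f \<zeta>))\<^sup>2 * (1 / \<rho> i)"
        by (intro mult_left_mono weight[OF \<open>\<zeta> \<in> \<T>\<close> i]) simp
      then have "ennreal ((cmod (f \<zeta>))\<^sup>2 * exp (16 / (cmod (1 - \<zeta>))\<^sup>2)) \<le> ennreal ((cmod (f \<zeta>))\<^sup>2 * (1 / \<rho> i))"
        by (rule ennreal_leI)
      also have "\<dots> = ennreal ((cmod (f \<zeta>))\<^sup>2) * ennreal (1 / \<rho> i)"
        using \<rho>(1)[of i] by (intro ennreal_mult) auto
      also have "\<dots> = ennreal (1 / \<rho> i) * ?B i \<zeta>"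
        using i by (simp add: mult.commute)
      also have "\<dots> \<le> (\<Sum>i. ennreal (1 / \<rho> i) * ?B i \<zeta>)"
        using sum_le_suminf[OF summableI, of "{i}" "\<lambda>i. ennreal (1 / \<rho> i) * ?B i \<zeta>"] by simp
      finally show ?case .
    qed
  qed
  also have "\<dots> = (\<Sum>i. \<integral>\<^sup>+\<zeta>. ennreal (1 / \<rho> i) * ?B i \<zeta> \<partial>arc_length)"
    by (rule nn_integral_suminf) measurable
  also have "\<dots> = (\<Sum>i. ennreal (1 / \<rho> i) * (\<integral>\<^sup>+\<zeta>. ?B i \<zeta> \<partial>arc_length))"
    by (intro suminf_cong nn_integral_cmult) measurable
  also have "\<dots> \<le> (\<Sum>i. ennreal (2320 * S) * (ennreal (pmf row i) * row_energy f i))"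
  proof (intro suminf_le summableI)
    fix i
    have "ennreal (1 / \<rho> i) * (\<integral>\<^sup>+\<zeta>. ?B i \<zeta> \<partial>arc_length)
        \<le> ennreal (1 / \<rho> i) * ennreal (1160 * (\<rho> i)\<^sup>2 * (2 * t i))"
      by (intro mult_left_mono B) simp
    also have "\<dots> = ennreal (1 / \<rho> i * (1160 * (\<rho> i)\<^sup>2 * (2 * t i)))"
      using \<rho>(1)[of i] t(2)[of i] by (intro ennreal_mult[symmetric]) auto
    \<comment> \<open>One factor \<open>\<rho> i\<close> cancels the weight, the other is the mass
      of the row up to \<open>S\<close>; the sum over \<open>i\<close> thus becomes the integral of
      the row energies.\<close>
    also have "1 / \<rho> i * (1160 * (\<rho> i)\<^sup>2 * (2 * t i)) = (2320 * S) * ((\<rho> i / S) * t i)"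
      using \<rho>(1)[of i] S_pos by (simp add: field_simps power2_eq_square)
    also have "ennreal \<dots> = ennreal (2320 * S) * (ennreal (\<rho> i / S) * ennreal (t i))"
      using \<rho>(1)[of i] S_pos t(2)[of i] by (simp only: ennreal_mult' less_imp_le mult_nonneg_nonneg divide_nonneg_pos zero_le_numeral)
    finally show "ennreal (1 / \<rho> i) * (\<integral>\<^sup>+\<zeta>. ?B i \<zeta> \<partial>arc_length)
        \<le> ennreal (2320 * S) * (ennreal (pmf row i) * row_energy f i)"
      by (simp only: pmf_row t(1))
  qed
  also have "\<dots> = ennreal (2320 * S) * (\<integral>\<^sup>+i. row_energy f i \<partial>measure_pmf row)"
    by (simp add: nn_integral_measure_pmf nn_integral_count_space_nat)
  also have "\<dots> < \<infinity>"
    using le_less_trans[OF nn_integral_row_energy D] by (simp add: ennreal_mult_less_top)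
  finally show "AE \<zeta> in arc_length. f \<zeta> = 0"
    by (intro analytic_AE_zero_if_weighted_L2[OF int]) (simp_all only: neg)
qed

lemma emeasure_E: "emeasure \<mu> E = 0"
proof -
  have E: "E \<in> sets circle_borel"
    using Int_circle_in_sets[of E] \<xi> countable_E
    by (simp add: E_def Int_absorb2 image_subset_iff borel_closed sets.countable)
  have "atom -` E = {}" using atom(2) by auto
  then show ?thesis
    unfolding \<mu>_def using E atom_circle
    by (subst emeasure_distr) (auto simp: space_circle_borel)
qed

lemma prob_space_\<mu>: "prob_space \<mu>"
  unfolding \<mu>_def using atom_circle
  by (intro measure_pmf.prob_space_distr) (auto simp: space_circle_borel)

end

subsection \<open>Nodes accumulating at \<open>1\<close>\<close>

text \<open>\<open>sin x - x / 2\<close> increases from 0 up to \<open>pi / 3\<close>, where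
  \<open>cos\<close> equals \<open>1 / 2\<close>, and then decreases to the value
  \<open>1 - pi / 4 > 0\<close> at \<open>pi / 2\<close>.\<close>

lemma half_le_sin:
  assumes "0 \<le> x" "x \<le> pi / 2"
  shows "x / 2 \<le> sin x"
proof -
  have der: "((\<lambda>x. sin x - x / 2) has_real_derivative cos y - 1 / 2) (at y)" for y
    by (auto intro!: derivative_eq_intros)
  show ?thesis
  proof (cases "x \<le> pi / 3")
    case True
    have "sin 0 - 0 / 2 \<le> sin x - x / 2"
    proof (rule DERIV_nonneg_imp_nondecreasing[OF assms(1)])
      fix y assume "0 \<le> y" "y \<le> x"
      then have "cos (pi / 3) \<le> cos y" using True by (intro cos_monotone_0_pi_le) auto
      then show "\<exists>d. ((\<lambda>x. sin x - x / 2) has_real_derivative d) (at y) \<and> 0 \<le> d"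
        using der[of y] by (auto simp: cos_60)
    qed
    then show ?thesis by simp
  next
    case False
    have "sin (pi / 2) - pi / 2 / 2 \<le> sin x - x / 2"
    proof (rule DERIV_nonpos_imp_nonincreasing[OF assms(2)])
      fix y assume "x \<le> y" "y \<le> pi / 2"
      then have "cos y \<le> cos (pi / 3)" using False pi_gt_zero by (intro cos_monotone_0_pi_le) auto
      then show "\<exists>d. ((\<lambda>x. sin x - x / 2) has_real_derivative d) (at y) \<and> d \<le> 0"
        using der[of y] by (auto simp: cos_60)
    qed
    then show ?thesis using pi_less_4 by simp
  qed
qed

text \<open>The reciprocal of the weight \<open>exp (16 / d\<^sup>2)\<close> at distance
  \<open>d = x / 4\<close>, a lower bound for the distance to 1 on the disc around a node of angle
  \<open>x\<close>.\<close>

definition gap :: "real \<Rightarrow> real" where "gap x = exp (- 256 / x\<^sup>2)"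

text \<open>Each angle steps towards 0 by its own gap, so the discs just reach from one angle to the
  next, and the gaps telescope to at most \<open>pi\<close> however small they are.\<close>

primrec angle :: "nat \<Rightarrow> real" where
  "angle 0 = pi"
| "angle (Suc k) = angle k - gap (angle k)"

lemma gap_pos: "0 < gap x" and gap_le_1: "gap x \<le> 1"
  by (simp_all add: gap_def)

lemma gap_mono: "0 < x \<Longrightarrow> x \<le> y \<Longrightarrow> gap x \<le> gap y"
  unfolding gap_def by (auto intro!: divide_left_mono power_mono)

lemma gap_le:
  assumes "0 < x" "x \<le> pi"
  shows "gap x \<le> x / 4"
proof -
  have "256 / x\<^sup>2 \<le> exp (256 / x\<^sup>2)"
    using exp_ge_add_one_self[of "256 / x\<^sup>2"] by linarith
  then have "inverse (exp (256 / x\<^sup>2)) \<le> inverse (256 / x\<^sup>2)"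
    using assms by (intro le_imp_inverse_le) auto
  then have "gap x \<le> x * x / 256"
    by (simp add: gap_def exp_minus power2_eq_square)
  also have "x * x \<le> 4 * x" using assms pi_less_4 by (intro mult_right_mono) auto
  finally show ?thesis using assms by simp
qed

lemma angle_bounds: "0 < angle k \<and> angle k \<le> pi"
proof (induction k)
  case (Suc k)
  then show ?case using gap_le[of "angle k"] gap_pos[of "angle k"] by simp
qed simp

lemma sum_gap: "(\<Sum>k<n. gap (angle k)) = pi - angle n"
  by (induction n) auto

lemma summable_gap: "summable (\<lambda>k. gap (angle k))"
proof (rule summableI_nonneg_bounded)
  show "(\<Sum>k<n. gap (angle k)) \<le> pi" for n using angle_bounds[of n] by (simp add: sum_gap)
qed (simp add: gap_pos less_imp_le)

text \<open>The gaps are summable, hence tend to 0; as \<open>gap\<close> is monotone, the angles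
  cannot stay above any \<open>e > 0\<close>.\<close>

lemma angle_tendsto: "angle \<longlonglongrightarrow> 0"
proof (rule LIMSEQ_I)
  fix e :: real assume "e > 0"
  have "(\<lambda>k. gap (angle k)) \<longlonglongrightarrow> 0" by (rule summable_LIMSEQ_zero[OF summable_gap])
  then have "\<forall>\<^sub>F k in sequentially. gap (angle k) < gap e"
    by (rule order_tendstoD) (rule gap_pos)
  then obtain n where n: "\<And>k. k \<ge> n \<Longrightarrow> gap (angle k) < gap e"
    by (auto simp: eventually_sequentially)
  have "norm (angle k - 0) < e" if "k \<ge> n" for k
    using n[OF that] angle_bounds[of k] gap_mono[OF \<open>e > 0\<close>, of "angle k"] by force
  then show "\<exists>n. \<forall>k\<ge>n. norm (angle k - 0) < e" by blast
qed

lemma angle_cover: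
  assumes "0 < t" "t \<le> pi"
  obtains k where "\<bar>angle k - t\<bar> \<le> gap (angle k)"
proof -
  have "\<exists>k. angle k < t"
    using order_tendstoD(2)[OF angle_tendsto assms(1)] by (auto simp: eventually_sequentially)
  \<comment> \<open>The first angle below \<open>t\<close> and its predecessor enclose
    \<open>t\<close>; a predecessor exists because \<open>angle 0 = pi \<ge> t\<close>.\<close>
  then obtain k where k: "angle k < t" "\<And>j. j < k \<Longrightarrow> \<not> angle j < t"
    unfolding exists_least_iff[of "\<lambda>k. angle k < t"] by blast
  have "k \<noteq> 0" using k(1) assms(2) by (intro notI) simp
  then obtain j where j: "k = Suc j" using not0_implies_Suc by blast
  then have "angle j - gap (angle j) < t" "t \<le> angle j" using k(1) k(2)[of j] j by auto
  then have "\<bar>angle j - t\<bar> \<le> gap (angle j)" by linarith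
  then show thesis by (rule that)
qed

section \<open>Symmetric nodes on the two half circles\<close>

definition node :: "nat \<Rightarrow> complex" where
  "node i = cis ((if even i then 1 else - 1) * angle (i div 2))"

definition radius :: "nat \<Rightarrow> real" where
  "radius i = gap (angle (i div 2))"

lemma cmod_one_minus_node: "angle (i div 2) / 2 \<le> cmod (1 - node i)"
proof -
  have "angle (i div 2) / 2 / 2 \<le> sin (angle (i div 2) / 2)"
    using angle_bounds[of "i div 2"] by (intro half_le_sin) auto
  then have "angle (i div 2) / 2 \<le> 2 * \<bar>sin (angle (i div 2) / 2)\<bar>" by linarith
  also have "\<dots> = cmod (cis 0 - node i)"
    unfolding node_def cmod_cis_diff by simp
  finally show ?thesis by simp
qed

lemma node_tendsto: "node \<longlonglongrightarrow> 1"
proof -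
  have "filterlim (\<lambda>i::nat. i div 2) at_top at_top"
    unfolding filterlim_at_top
  proof
    fix n :: nat
    show "\<forall>\<^sub>F i in sequentially. n \<le> i div 2"
      using eventually_ge_at_top[of "2 * n"] by eventually_elim auto
  qed
  then have lim: "(\<lambda>i. angle (i div 2)) \<longlonglongrightarrow> 0"
    by (rule filterlim_compose[OF angle_tendsto])
  have "(\<lambda>i. node i - 1) \<longlonglongrightarrow> 0"
  proof (rule Lim_null_comparison[OF _ lim])
    have "cmod (node i - 1) \<le> angle (i div 2)" for i
      using dist_cis_le[of "(if even i then 1 else - 1) * angle (i div 2)" 0] angle_bounds[of "i div 2"]
      by (simp add: node_def split: if_splits)
    then show "\<forall>\<^sub>F i in sequentially. norm (node i - 1) \<le> angle (i div 2)" by simp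
  qed
  then show ?thesis by (rule LIM_zero_cancel)
qed

lemma arc_cover_node: "arc_cover node radius"
proof
  show "node i \<in> \<T>" for i by (simp add: node_def)
  show "0 < radius i" "radius i \<le> 1" for i by (simp_all add: radius_def gap_pos gap_le_1)
  \<comment> \<open>Every gap occurs twice, for a node and its conjugate.\<close>
  have double: "(\<Sum>i<2 * n. radius i) = 2 * (\<Sum>k<n. gap (angle k))" for n
    by (induction n) (simp_all add: radius_def)
  show "summable radius"
  proof (rule summableI_nonneg_bounded)
    fix n
    show "0 \<le> radius n" by (simp add: radius_def gap_pos less_imp_le)
    have "(\<Sum>i<n. radius i) \<le> (\<Sum>i<2 * n. radius i)"
      by (intro sum_mono2) (auto simp: radius_def gap_pos less_imp_le)
    also have "\<dots> \<le> 2 * pi" using angle_bounds[of n] by (simp add: double sum_gap)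
    finally show "(\<Sum>i<n. radius i) \<le> 2 * pi" .
  qed
  show "\<exists>i. \<zeta> \<in> cball (node i) (radius i)" if "\<zeta> \<in> \<T>" "\<zeta> \<noteq> 1" for \<zeta>
  proof -
    have "\<zeta> \<noteq> 0" "cmod \<zeta> = 1" using that by auto
    then have cis: "cis (Arg \<zeta>) = \<zeta>" by (simp add: cis_Arg sgn_eq)
    have Arg: "- pi < Arg \<zeta>" "Arg \<zeta> \<le> pi" using Arg_bounded[of \<zeta>] by auto
    have "Arg \<zeta> \<noteq> 0" using cis that by auto
    with Arg have "0 < \<bar>Arg \<zeta>\<bar>" "\<bar>Arg \<zeta>\<bar> \<le> pi" by auto
    then obtain k where k: "\<bar>angle k - \<bar>Arg \<zeta>\<bar>\<bar> \<le> gap (angle k)"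
      by (rule angle_cover)
    \<comment> \<open>The parity of the index selects the half circle containing
      \<open>\<zeta>\<close>.\<close>
    define i where "i = (if Arg \<zeta> > 0 then 2 * k else 2 * k + 1)"
    have "dist (node i) \<zeta> \<le> \<bar>(if even i then 1 else - 1) * angle (i div 2) - Arg \<zeta>\<bar>"
      unfolding node_def dist_norm by (subst cis[symmetric], rule dist_cis_le)
    also have "\<dots> = \<bar>angle k - \<bar>Arg \<zeta>\<bar>\<bar>" by (auto simp: i_def)
    also have "\<dots> \<le> radius i" using k by (auto simp: radius_def i_def)
    finally show ?thesis by auto
  qed
  show "exp (16 / (cmod (1 - \<zeta>))\<^sup>2) \<le> 1 / radius i" if "\<zeta> \<in> cball (node i) (radius i)" for \<zeta> i
  proof -
    let ?\<theta> = "angle (i div 2)"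
    have \<theta>: "0 < ?\<theta>" "?\<theta> \<le> pi" using angle_bounds[of "i div 2"] by auto
    have "cmod (1 - node i) \<le> cmod (1 - \<zeta>) + cmod (node i - \<zeta>)"
      using norm_triangle_ineq4[of "1 - \<zeta>" "node i - \<zeta>"] by simp
    also have "cmod (node i - \<zeta>) \<le> ?\<theta> / 4"
      using that gap_le[OF \<theta>] by (simp add: dist_norm radius_def)
    \<comment> \<open>The node is at distance at least \<open>?\<theta> / 2\<close> from 1, and the
      disc uses up at most half of that.\<close>
    finally have "?\<theta> / 4 \<le> cmod (1 - \<zeta>)" using cmod_one_minus_node[of i] by linarith
    then have pos: "0 < cmod (1 - \<zeta>)" using \<theta> by linarith
    have "(?\<theta> / 4)\<^sup>2 \<le> (cmod (1 - \<zeta>))\<^sup>2" using \<theta> \<open>?\<theta> / 4 \<le> cmod (1 - \<zeta>)\<close> by (intro power_mono) auto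
    then have "16 / (cmod (1 - \<zeta>))\<^sup>2 \<le> 16 / (?\<theta> / 4)\<^sup>2"
      using \<theta> pos by (intro divide_left_mono mult_pos_pos zero_less_power) simp_all
    also have "\<dots> = 256 / ?\<theta>\<^sup>2" by (simp add: power_divide)
    finally show ?thesis by (simp add: radius_def gap_def exp_minus inverse_eq_divide[symmetric])
  qed
qed

theorem corollary3p6:
  shows "\<exists>(\<mu> :: complex measure) (E :: complex set).
    sets \<mu> = sets circle_borel \<and> prob_space \<mu> \<and> discrete_measure \<mu> \<and>
    E \<subseteq> \<T> \<and> closed E \<and> countable E \<and> emeasure \<mu> E = 0 \<and> uniqueness_set \<mu> E"
proof -
  interpret arc_cover node radius by (rule arc_cover_node)
  show ?thesis
  proof (intro exI conjI)
    show "sets \<mu> = sets circle_borel" by (simp add: \<mu>_def)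
    show "discrete_measure \<mu>"
      unfolding \<mu>_def by (rule discrete_measure_distr_pmf) (rule atom_circle)
    show "E \<subseteq> \<T>" using \<xi> by (auto simp: E_def)
    show "closed E"
      \<comment> \<open>A convergent sequence together with its limit, here the point 1, is
        compact.\<close>
      unfolding E_def by (rule compact_imp_closed[OF compact_sequence_with_limit[OF node_tendsto]])
  qed (fact prob_space_\<mu> countable_E emeasure_E uniqueness)+
qed

end
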